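(* Let $(L_t)_{t\ge0}$ be a Lévy process as in the context with no Gaussian component ($\sigma^2=0$), whose Lévy density satisfies $\int x^2n(x)\,dx<\infty$, $\int x^4n(x)\,dx<\infty$ and $h\in\mathbb{L}^2(\mathbb{R})$, where $h(x)=x^2n(x)$. Then, for every cut-off parameter $m>0$, $$\mathbb{E}(\|\hat h_m-h\|^2)\le\|h_m-h\|^2+72\,\mathbb{E}(Z_1^4/\Delta)\frac{m}{n\Delta}+\frac{4\Delta^2}{\pi}\int_{-\pi m}^{\pi m}u^2c^2(u)|h^*(u)|^2\,du,$$ $$\mathbb{E}(\|\bar h_m-h\|^2)\le\|h_m-h\|^2+\mathbb{E}(Z_1^4/\Delta)\frac{m}{n\Delta}+\frac{2\Delta^2}{\pi}\int_{-\pi m}^{\pi m}u^2c^2(u)|h^*(u)|^2\,du+C\Delta^2B_m,$$ with $C$ a constant, $c(u)=|b|+\big|\int_0^u|h^*(v)|\,dv\big|$, and $B_m=\frac2\pi\int_{-\pi m}^{\pi m}|\phi(u)|^4\,du$, where $\phi(u)=ib-\int_0^uh^*(v)\,dv$. Moreover $B_m=O(m)$ if $h^*\in\mathbb{L}^1(\mathbb{R})$, and $B_m=O(m^5)$ otherwise.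
   Context: Under $\int x^2n(x)\,dx<\infty$, $(L_t)$ is a real Lévy process with characteristic function $\mathbb{E}(e^{iuL_t})=\exp\{t(iub-\frac12u^2\sigma^2+\int_{\mathbb{R}}(e^{iux}-1-iux)n(x)\,dx)\}$, where $b=\mathbb{E}L_1$ and $n(\cdot)$ is the Lévy density; here $\sigma^2=0$. Observations: $Z_k=L_{k\Delta}-L_{(k-1)\Delta}$, $1\le k\le 2n$ (i.i.d.), with sampling step $\Delta>0$. Notation: $f^*(u)=\int e^{iux}f(x)\,dx$; $\|f\|^2=\int|f(x)|^2dx$; $h_m(x)=\frac1{2\pi}\int_{-\pi m}^{\pi m}e^{-iux}h^*(u)\,du$. Empirical quantities: for $j=0,1,2$ and $q=1,2$, $\hat\psi^{(j)}_{\Delta,q}(u)=\frac1n\sum_{k=1+(q-1)n}^{qn}(iZ_k)^je^{iuZ_k}$, and $\hat\psi^{(2)}_\Delta(u)=\frac1{2n}\sum_{k=1}^{2n}(iZ_k)^2e^{iuZ_k}$. Estimators: $\hat h^*(u)=\frac1\Delta\big(\hat\psi^{(1)}_{\Delta,1}(u)\hat\psi^{(1)}_{\Delta,2}(u)-\hat\psi^{(2)}_{\Delta,1}(u)\hat\psi^{(0)}_{\Delta,2}(u)\big)$, $\bar h^*(u)=-\frac1\Delta\hat\psi^{(2)}_\Delta(u)$, $\hat h_m(x)=\frac1{2\pi}\int_{-\pi m}^{\pi m}e^{-iux}\hat h^*(u)\,du$, $\bar h_m(x)=\frac1{2\pi}\int_{-\pi m}^{\pi m}e^{-iux}\bar h^*(u)\,du$.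 *)

theory Defs
  imports "HOL-Probability.Probability" "HOL-Library.Landau_Symbols"
begin

section \<open>Levy processes\<close>

(* Stochastic continuity is required but cadlag paths are not, so both common conventions
   for the term "Levy process" are covered. Time is t >= 0; L is never used at t < 0. *)
locale levy_process = prob_space M
  for M :: "'a measure" and L :: "real \<Rightarrow> 'a \<Rightarrow> real" +
  assumes random_variable_L: "\<And>t. t \<ge> 0 \<Longrightarrow> L t \<in> borel_measurable M"
    and start_zero: "AE \<omega> in M. L 0 \<omega> = 0"
    and independent_increments:
      "\<And>(s :: nat \<Rightarrow> real) k. s 0 \<ge> 0 \<Longrightarrow> (\<And>i. i < k \<Longrightarrow> s i \<le> s (Suc i)) \<Longrightarrow>
         indep_vars (\<lambda>_. borel) (\<lambda>i \<omega>. L (s (Suc i)) \<omega> - L (s i) \<omega>) {..<k}"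
    and stationary_increments:
      "\<And>s t. s \<ge> 0 \<Longrightarrow> t \<ge> 0 \<Longrightarrow>
         distr M borel (\<lambda>\<omega>. L (s + t) \<omega> - L s \<omega>) = distr M borel (L t)"
    and stochastic_continuity:
      "\<And>t \<epsilon>. t \<ge> 0 \<Longrightarrow> \<epsilon> > 0 \<Longrightarrow>
         ((\<lambda>s. prob {\<omega> \<in> space M. \<bar>L s \<omega> - L t \<omega>\<bar> > \<epsilon>}) \<longlongrightarrow> 0) (at t within {0..})"

definition levy_exponent :: "real \<Rightarrow> real \<Rightarrow> (real \<Rightarrow> real) \<Rightarrow> real \<Rightarrow> complex" where
  "levy_exponent b \<sigma>2 \<nu> u =
     \<i> * of_real (u * b) - of_real (u\<^sup>2 * \<sigma>2 / 2)
     + (LINT x|lborel. (iexp (u * x) - 1 - \<i> * of_real (u * x)) * of_real (\<nu> x))"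

definition levy_mean :: "'a measure \<Rightarrow> (real \<Rightarrow> 'a \<Rightarrow> real) \<Rightarrow> real" where
  "levy_mean M L = (LINT \<omega>|M. L 1 \<omega>)"

definition levy_h :: "(real \<Rightarrow> real) \<Rightarrow> real \<Rightarrow> real" where
  "levy_h \<nu> x = x\<^sup>2 * \<nu> x"

(* The Levy density is called \<nu> because n denotes the (half) sample size below. *)
locale pure_jump_levy = levy_process M L
  for M :: "'a measure" and L :: "real \<Rightarrow> 'a \<Rightarrow> real" +
  fixes \<nu> :: "real \<Rightarrow> real"
  assumes density_measurable: "\<nu> \<in> borel_measurable borel"
    and density_nonneg: "\<And>x. \<nu> x \<ge> 0"
    and density_second_moment: "integrable lborel (\<lambda>x. x\<^sup>2 * \<nu> x)"
    and density_fourth_moment: "integrable lborel (\<lambda>x. x ^ 4 * \<nu> x)"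
    and h_square_integrable: "integrable lborel (\<lambda>x. (levy_h \<nu> x)\<^sup>2)"
    and characteristic_function:
      "\<And>t u. t \<ge> 0 \<Longrightarrow>
         char (distr M borel (L t)) u = exp (of_real t * levy_exponent (levy_mean M L) 0 \<nu> u)"

section \<open>Fourier notation\<close>

definition fourier :: "(real \<Rightarrow> real) \<Rightarrow> real \<Rightarrow> complex" where
  "fourier f u = (LINT x|lborel. iexp (u * x) * of_real (f x))"

definition spectral_cutoff :: "(real \<Rightarrow> complex) \<Rightarrow> real \<Rightarrow> real \<Rightarrow> complex" where
  "spectral_cutoff g m x =
     of_real (1 / (2 * pi)) * (LBINT u:{- (pi * m)..pi * m}. iexp (- (u * x)) * g u)"

definition L2_norm_sq :: "(real \<Rightarrow> complex) \<Rightarrow> ennreal" where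
  "L2_norm_sq f = (\<integral>\<^sup>+ x. ennreal ((norm (f x))\<^sup>2) \<partial>lborel)"

section \<open>Observations and estimators\<close>

definition Z :: "(real \<Rightarrow> 'a \<Rightarrow> real) \<Rightarrow> real \<Rightarrow> nat \<Rightarrow> 'a \<Rightarrow> real" where
  "Z L \<Delta> k \<omega> = L (real k * \<Delta>) \<omega> - L ((real k - 1) * \<Delta>) \<omega>"

definition psi_hat ::
  "(real \<Rightarrow> 'a \<Rightarrow> real) \<Rightarrow> real \<Rightarrow> nat \<Rightarrow> nat \<Rightarrow> nat \<Rightarrow> 'a \<Rightarrow> real \<Rightarrow> complex" where
  "psi_hat L \<Delta> n j q \<omega> u =
     of_real (1 / real n) *
     (\<Sum>k = 1 + (q - 1) * n..q * n. (\<i> * of_real (Z L \<Delta> k \<omega>)) ^ j * iexp (u * Z L \<Delta> k \<omega>))"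

definition psi2_hat_full ::
  "(real \<Rightarrow> 'a \<Rightarrow> real) \<Rightarrow> real \<Rightarrow> nat \<Rightarrow> 'a \<Rightarrow> real \<Rightarrow> complex" where
  "psi2_hat_full L \<Delta> n \<omega> u =
     of_real (1 / (2 * real n)) *
     (\<Sum>k = 1..2 * n. (\<i> * of_real (Z L \<Delta> k \<omega>))\<^sup>2 * iexp (u * Z L \<Delta> k \<omega>))"

definition h_hat_star ::
  "(real \<Rightarrow> 'a \<Rightarrow> real) \<Rightarrow> real \<Rightarrow> nat \<Rightarrow> 'a \<Rightarrow> real \<Rightarrow> complex" where
  "h_hat_star L \<Delta> n \<omega> u =
     of_real (1 / \<Delta>) *
     (psi_hat L \<Delta> n 1 1 \<omega> u * psi_hat L \<Delta> n 1 2 \<omega> u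
      - psi_hat L \<Delta> n 2 1 \<omega> u * psi_hat L \<Delta> n 0 2 \<omega> u)"

definition h_bar_star ::
  "(real \<Rightarrow> 'a \<Rightarrow> real) \<Rightarrow> real \<Rightarrow> nat \<Rightarrow> 'a \<Rightarrow> real \<Rightarrow> complex" where
  "h_bar_star L \<Delta> n \<omega> u = - of_real (1 / \<Delta>) * psi2_hat_full L \<Delta> n \<omega> u"

definition h_hat ::
  "(real \<Rightarrow> 'a \<Rightarrow> real) \<Rightarrow> real \<Rightarrow> nat \<Rightarrow> real \<Rightarrow> 'a \<Rightarrow> real \<Rightarrow> complex" where
  "h_hat L \<Delta> n m \<omega> = spectral_cutoff (h_hat_star L \<Delta> n \<omega>) m"

definition h_bar ::
  "(real \<Rightarrow> 'a \<Rightarrow> real) \<Rightarrow> real \<Rightarrow> nat \<Rightarrow> real \<Rightarrow> 'a \<Rightarrow> real \<Rightarrow> complex" where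
  "h_bar L \<Delta> n m \<omega> = spectral_cutoff (h_bar_star L \<Delta> n \<omega>) m"

definition h_cutoff :: "(real \<Rightarrow> real) \<Rightarrow> real \<Rightarrow> real \<Rightarrow> complex" where
  "h_cutoff h m = spectral_cutoff (fourier h) m"

section \<open>Quantities in the risk bounds\<close>

(* The integrals from 0 to u are oriented: for u < 0 they change sign. *)
definition c_fun :: "real \<Rightarrow> (real \<Rightarrow> real) \<Rightarrow> real \<Rightarrow> real" where
  "c_fun b h u = \<bar>b\<bar> + \<bar>LBINT v=0..u. norm (fourier h v)\<bar>"

definition phi_fun :: "real \<Rightarrow> (real \<Rightarrow> real) \<Rightarrow> real \<Rightarrow> complex" where
  "phi_fun b h u = \<i> * of_real b - (LBINT v=0..u. fourier h v)"

definition bias_integral :: "real \<Rightarrow> (real \<Rightarrow> real) \<Rightarrow> real \<Rightarrow> real" where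
  "bias_integral b h m =
     (LBINT u:{- (pi * m)..pi * m}. u\<^sup>2 * (c_fun b h u)\<^sup>2 * (norm (fourier h u))\<^sup>2)"

definition B_fun :: "real \<Rightarrow> (real \<Rightarrow> real) \<Rightarrow> real \<Rightarrow> real" where
  "B_fun b h m = 2 / pi * (LBINT u:{- (pi * m)..pi * m}. norm (phi_fun b h u) ^ 4)"

end

theory Submission
  imports Defs
begin

text \<open>
  Write \<open>\<kappa>\<close> for the Levy exponent and \<open>\<psi> = exp (\<Delta> \<kappa>)\<close> for the characteristic function of an increment.
  The exponent satisfies \<open>\<kappa>' = \<phi>\<close> and \<open>\<phi>' = - h\<^sup>*\<close>, so that \<open>\<psi>' = \<Delta> \<phi> \<psi>\<close> and
  \<open>\<psi>'' = (- \<Delta> h\<^sup>* + \<Delta>\<^sup>2 \<phi>\<^sup>2) \<psi>\<close>. Consequently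
  \<open>(\<psi>'\<^sup>2 - \<psi>'' \<psi>) / \<Delta> = h\<^sup>* \<psi>\<^sup>2\<close> and \<open>- \<psi>'' / \<Delta> = (h\<^sup>* - \<Delta> \<phi>\<^sup>2) \<psi>\<close>:
  the two estimators replace the derivatives of \<open>\<psi>\<close> by empirical means, and each of them is biased for
  \<open>h\<^sup>*\<close> only through \<open>\<psi> - 1\<close>, which is at most \<open>\<Delta> \<bar>u\<bar> c(u)\<close>, and, for the second, through \<open>\<Delta> \<phi>\<^sup>2 \<psi>\<close>.

  The passage from \<open>h\<^sup>*\<close> to \<open>h\<close> is Plancherel's identity. The error of a spectral cutoff is the orthogonal sum of
  \<open>h\<^sub>m - h\<close>, whose Fourier transform lives off the band \<open>[-\<pi>m, \<pi>m]\<close>, and of a function whose transform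
  lives on the band (\<open>L2_norm_sq_cutoff_decomposition\<close>). After taking expectations it remains to bound
  the expected squared error of the estimate of \<open>h\<^sup>*(u)\<close> for each \<open>u\<close> and to integrate the bound over the band
  (\<open>integrated_risk_le\<close>).

  The pointwise bound uses \<open>\<bar>x + y\<bar>\<^sup>2 \<le> 2 \<bar>x\<bar>\<^sup>2 + 2 \<bar>y\<bar>\<^sup>2\<close> to separate the random part from
  the bias; the constants of the proposition leave room for this factor 2. The random part is controlled by the variance of
  independent means. For the product estimator the two factors come from disjoint halves of the sample, so second
  moments factorise and only \<open>E Z\<^sup>4\<close> is needed (\<open>split_sample_numerator_error\<close>). The fourth moment of \<open>Z\<close> is
  finite because a measure whose Fourier transform is twice continuously differentiable has a second moment
  (\<open>integrable_square_if_char_C2\<close>); this is applied first to the law of the increment and then to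
  \<open>z\<^sup>2\<close> times that law, the second time using \<open>\<integral> x\<^sup>4 \<nu>(x) dx < \<infinity>\<close>.

  Finally \<open>\<phi>\<close> is bounded if \<open>h\<^sup>*\<close> is integrable and grows at most linearly in any case, which gives
  the two growth rates of the term \<open>B\<^sub>m\<close>. The constant of the proposition can be taken to be 1.
\<close>

section \<open>Fourier integrals and their derivatives\<close>

lemma norm_diff_le_of_vector_derivative:
  fixes f :: "real \<Rightarrow> 'b::real_normed_vector"
  assumes "convex S" and f: "\<And>t. t \<in> S \<Longrightarrow> (f has_vector_derivative f' t) (at t within S)"
    and B: "\<And>t. t \<in> S \<Longrightarrow> norm (f' t) \<le> B" and "x \<in> S" "y \<in> S"
  shows "norm (f x - f y) \<le> B * \<bar>x - y\<bar>"
proof -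
  have "norm (f x - f y) \<le> B * norm (x - y)"
  proof (rule differentiable_bound[OF \<open>convex S\<close> _ _ \<open>x \<in> S\<close> \<open>y \<in> S\<close>])
    show "(f has_derivative (\<lambda>h. h *\<^sub>R f' t)) (at t within S)" if "t \<in> S" for t
      using f[OF that] by (simp add: has_vector_derivative_def)
    show "onorm (\<lambda>h. h *\<^sub>R f' t) \<le> B" if "t \<in> S" for t
    proof (rule onorm_le)
      fix h :: real
      show "norm (h *\<^sub>R f' t) \<le> B * norm h"
        using mult_right_mono[OF B[OF that], of "\<bar>h\<bar>"] by (simp add: mult.commute)
    qed
  qed
  then show ?thesis by simp
qed

text \<open>The difference quotients stay below \<open>2 w\<close> by the mean value inequality, so dominated convergence applies
  along every sequence tending to \<open>u0\<close>. A domination that is local in \<open>u\<close> is needed because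
  the derivative of the integrand of the Levy exponent is of order \<open>\<bar>u\<bar> x\<^sup>2 \<nu> x\<close>.\<close>
lemma has_vector_derivative_integral_dominated:
  fixes F F' :: "real \<Rightarrow> 'b \<Rightarrow> complex"
  assumes int: "\<And>u. integrable N (F u)"
    and meas[measurable]: "F' u0 \<in> borel_measurable N"
    and deriv: "\<And>u x. ((\<lambda>u. F u x) has_vector_derivative F' u x) (at u)"
    and bound: "\<And>u x. \<bar>u - u0\<bar> \<le> 1 \<Longrightarrow> norm (F' u x) \<le> w x"
    and w: "integrable N w"
  shows "((\<lambda>u. LINT x|N. F u x) has_vector_derivative (LINT x|N. F' u0 x)) (at u0)"
proof -
  define S where "S = {u0 - 1..u0 + 1}"
  note [measurable] = borel_measurable_integrable[OF int]
  have int': "integrable N (F' u0)"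
    by (rule Bochner_Integration.integrable_bound[OF w meas])
       (use bound[of u0] in \<open>auto intro!: AE_I2 order_trans[OF _ abs_ge_self]\<close>)
  have lip: "norm (F u x - F u0 x) \<le> w x * \<bar>u - u0\<bar>" if "u \<in> S" for u x
    by (rule norm_diff_le_of_vector_derivative[of S _ "\<lambda>u. F' u x"])
       (use that bound in \<open>auto simp: S_def abs_le_iff intro!: has_vector_derivative_at_within deriv\<close>)
  have "((\<lambda>u. LINT x|N. F u x) has_vector_derivative (LINT x|N. F' u0 x)) (at u0 within S)"
    unfolding has_vector_derivative_def has_derivative_at_within
  proof (intro conjI bounded_linear_scaleR_left)
    show "((\<lambda>y. ((LINT x|N. F y x) - (LINT x|N. F u0 x) - (y - u0) *\<^sub>R (LINT x|N. F' u0 x)) /\<^sub>R norm (y - u0))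
       \<longlongrightarrow> 0) (at u0 within S)"
      unfolding tendsto_at_iff_sequentially comp_def
    proof (intro allI impI)
      fix X :: "nat \<Rightarrow> real" assume X: "\<forall>i. X i \<in> S - {u0}" "X \<longlonglongrightarrow> u0"
      let ?q = "\<lambda>i x. (F (X i) x - F u0 x - (X i - u0) *\<^sub>R F' u0 x) /\<^sub>R norm (X i - u0)"
      have "(\<lambda>i. LINT x|N. ?q i x) \<longlonglongrightarrow> (LINT x|N. 0)"
      proof (rule integral_dominated_convergence[where w = "\<lambda>x. 2 * w x"])
        show "AE x in N. (\<lambda>i. ?q i x) \<longlonglongrightarrow> 0"
        proof (rule AE_I2)
          fix x
          have "((\<lambda>u. F u x) has_vector_derivative F' u0 x) (at u0 within S)"
            by (rule has_vector_derivative_at_within[OF deriv])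
          then show "(\<lambda>i. ?q i x) \<longlonglongrightarrow> 0"
            using X unfolding has_vector_derivative_def has_derivative_at_within tendsto_at_iff_sequentially comp_def
            by blast
        qed
        show "AE x in N. norm (?q i x) \<le> 2 * w x" for i
        proof (rule AE_I2)
          fix x
          have pos: "\<bar>X i - u0\<bar> > 0" using X(1) by auto
          have "norm (F (X i) x - F u0 x - (X i - u0) *\<^sub>R F' u0 x)
              \<le> norm (F (X i) x - F u0 x) + norm ((X i - u0) *\<^sub>R F' u0 x)"
            by (rule norm_triangle_ineq4)
          also have "\<dots> \<le> w x * \<bar>X i - u0\<bar> + \<bar>X i - u0\<bar> * w x"
            using lip[of "X i" x] X(1) bound[of u0 x] by (intro add_mono) (auto intro!: mult_left_mono)
          finally have "norm (F (X i) x - F u0 x - (X i - u0) *\<^sub>R F' u0 x) \<le> 2 * w x * \<bar>X i - u0\<bar>"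
            by (simp add: mult_ac)
          then have "norm (F (X i) x - F u0 x - (X i - u0) *\<^sub>R F' u0 x) / \<bar>X i - u0\<bar> \<le> 2 * w x"
            using pos by (simp only: pos_divide_le_eq)
          moreover have "norm (?q i x) = norm (F (X i) x - F u0 x - (X i - u0) *\<^sub>R F' u0 x) / \<bar>X i - u0\<bar>"
            unfolding norm_scaleR by (simp add: divide_inverse)
          ultimately show "norm (?q i x) \<le> 2 * w x" by (simp only:)
        qed
      qed (use w in auto)
      moreover have eq: "(LINT x|N. ?q i x) =
         ((LINT x|N. F (X i) x) - (LINT x|N. F u0 x) - (X i - u0) *\<^sub>R (LINT x|N. F' u0 x)) /\<^sub>R norm (X i - u0)" for i
        using int int' by (simp only: Bochner_Integration.integral_scaleR_right Bochner_Integration.integral_diff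
          Bochner_Integration.integrable_diff integrable_scaleR_right)
      ultimately show "(\<lambda>i. ((LINT x|N. F (X i) x) - (LINT x|N. F u0 x) - (X i - u0) *\<^sub>R (LINT x|N. F' u0 x)) /\<^sub>R norm (X i - u0)) \<longlonglongrightarrow> 0"
        by (simp only: eq Bochner_Integration.integral_zero)
    qed
  qed
  moreover have "at u0 within S = at u0"
    by (rule at_within_interior) (simp add: S_def)
  ultimately show ?thesis by simp
qed

lemma has_vector_derivative_iexp_linear:
  "((\<lambda>u. iexp (u * x)) has_vector_derivative \<i> * of_real x * iexp (u * x)) (at u)"
proof -
  have "((\<lambda>u. complex_of_real (u * x)) has_vector_derivative of_real x) (at u)"
    by (rule has_vector_derivative_of_real) (auto intro!: derivative_eq_intros)
  then have 1: "((\<lambda>u. \<i> * complex_of_real (u * x)) has_vector_derivative \<i> * of_real x) (at u)"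
    by (rule has_vector_derivative_mult_right)
  have "((\<lambda>z. exp z) has_field_derivative exp (\<i> * complex_of_real (u * x))) (at (\<i> * complex_of_real (u * x)))"
    by (rule DERIV_exp)
  from field_vector_diff_chain_at[OF 1 this] show ?thesis by (simp add: o_def)
qed

lemma isCont_integral_iexp:
  fixes w :: "'b \<Rightarrow> complex"
  assumes [measurable]: "X \<in> borel_measurable N" and w: "integrable N w"
  shows "isCont (\<lambda>u. LINT x|N. iexp (u * X x) * w x) u"
proof (unfold continuous_at_sequentially comp_def, intro allI impI)
  fix U :: "nat \<Rightarrow> real" assume U: "U \<longlonglongrightarrow> u"
  note [measurable] = borel_measurable_integrable[OF w]
  show "(\<lambda>j. LINT x|N. iexp (U j * X x) * w x) \<longlonglongrightarrow> (LINT x|N. iexp (u * X x) * w x)"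
  proof (rule integral_dominated_convergence[where w = "\<lambda>x. norm (w x)"])
    show "AE x in N. (\<lambda>j. iexp (U j * X x) * w x) \<longlonglongrightarrow> iexp (u * X x) * w x"
      by (intro AE_I2 tendsto_intros U)
  qed (use w in \<open>auto simp: norm_mult\<close>)
qed

lemma integrable_iexp_mult:
  fixes w :: "'b \<Rightarrow> complex"
  assumes [measurable]: "X \<in> borel_measurable N" and w: "integrable N w"
  shows "integrable N (\<lambda>x. iexp (u * X x) * w x)"
proof -
  note [measurable] = borel_measurable_integrable[OF w]
  show ?thesis
    by (rule Bochner_Integration.integrable_bound[OF w]) (auto simp: norm_mult)
qed

text \<open>The weight \<open>w\<close> is complex so that the lemma can be iterated: the derivative is again of the same form,
  with weight \<open>\<i> X w\<close>.\<close>
lemma has_vector_derivative_integral_iexp: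
  fixes w :: "'b \<Rightarrow> complex"
  assumes X[measurable]: "X \<in> borel_measurable N" and w: "integrable N w"
    and Xw: "integrable N (\<lambda>x. of_real (X x) * w x)"
  shows "((\<lambda>u. LINT x|N. iexp (u * X x) * w x) has_vector_derivative
            (LINT x|N. iexp (u * X x) * (\<i> * of_real (X x) * w x))) (at u)"
proof (rule has_vector_derivative_integral_dominated[where w = "\<lambda>x. norm (of_real (X x) * w x)"])
  note [measurable] = borel_measurable_integrable[OF w]
  show "integrable N (\<lambda>x. iexp (u * X x) * w x)" for u
    by (rule integrable_iexp_mult[OF X w])
  show "(\<lambda>x. iexp (u * X x) * (\<i> * of_real (X x) * w x)) \<in> borel_measurable N"
    by measurable
  show "((\<lambda>u. iexp (u * X x) * w x) has_vector_derivative iexp (u * X x) * (\<i> * of_real (X x) * w x)) (at u)" for u x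
    using has_vector_derivative_mult_left[OF has_vector_derivative_iexp_linear[of "X x" u], of "w x"]
    by (simp add: mult_ac)
qed (use integrable_norm[OF Xw] in \<open>simp_all add: norm_mult\<close>)

lemma isCont_fourier:
  assumes "integrable lborel f"
  shows "isCont (fourier f) u"
  unfolding fourier_def[abs_def] by (rule isCont_integral_iexp) (use assms in simp_all)

lemma continuous_on_fourier: "integrable lborel f \<Longrightarrow> continuous_on S (fourier f)"
  by (simp add: continuous_at_imp_continuous_on isCont_fourier)

section \<open>Plancherel's identity for spectral cutoffs\<close>

text \<open>The order of the factors is the one in which a Fourier transform is moved from one
  function to another; the kernels are characters of modulus 1.\<close>
lemma Fubini_bounded_kernel:
  fixes f :: "'a \<Rightarrow> complex" and g :: "'b \<Rightarrow> complex" and K :: "'a \<Rightarrow> 'b \<Rightarrow> complex"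
  assumes M1: "sigma_finite_measure M1" and M2: "sigma_finite_measure M2"
    and f: "integrable M1 f" and g: "integrable M2 g"
    and K[measurable]: "case_prod K \<in> borel_measurable (M1 \<Otimes>\<^sub>M M2)"
    and bound: "\<And>x y. norm (K x y) \<le> 1"
  shows "(LINT x|M1. f x * (LINT y|M2. g y * K x y)) = (LINT y|M2. g y * (LINT x|M1. f x * K x y))"
proof -
  interpret M1: sigma_finite_measure M1 by fact
  interpret M2: sigma_finite_measure M2 by fact
  interpret pair_sigma_finite M1 M2 ..
  note [measurable] = borel_measurable_integrable[OF f] borel_measurable_integrable[OF g]
  have fg: "integrable (M1 \<Otimes>\<^sub>M M2) (\<lambda>(x, y). f x * g y)"
  proof (rule Fubini_integrable)
    show "integrable M1 (\<lambda>x. LINT y|M2. norm (case (x, y) of (x, y) \<Rightarrow> f x * g y))"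
      using f by (simp add: norm_mult)
    show "AE x in M1. integrable M2 (\<lambda>y. case (x, y) of (x, y) \<Rightarrow> f x * g y)"
      using g by simp
  qed measurable
  have "integrable (M1 \<Otimes>\<^sub>M M2) (\<lambda>(x, y). f x * g y * K x y)"
  proof (rule Bochner_Integration.integrable_bound[OF fg])
    show "AE p in M1 \<Otimes>\<^sub>M M2. norm (case p of (x, y) \<Rightarrow> f x * g y * K x y)
        \<le> norm (case p of (x, y) \<Rightarrow> f x * g y)"
      using mult_left_mono[OF bound, of "norm (f x) * norm (g y)" for x y]
      by (intro AE_I2) (auto simp: norm_mult)
  qed measurable
  from Fubini_integral[OF this]
  have "(LINT y|M2. LINT x|M1. g y * (f x * K x y)) = (LINT x|M1. LINT y|M2. f x * (g y * K x y))"
    by (simp add: mult.commute mult.left_commute)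
  then show ?thesis by simp
qed

text \<open>The damping factor makes the integral of the squared transform absolutely convergent, so that Fubini can be used on the
  two copies of \<open>G\<close>. The inner integral over the frequency is then the characteristic function of a normal law
  at \<open>(v - u) / e\<close>, which is again Gaussian, and the substitution \<open>v = u + e * w\<close> turns it into a
  normal average of translates of \<open>k\<close> on the scale \<open>e\<close>.\<close>
lemma gaussian_damped_energy:
  fixes k :: "real \<Rightarrow> complex" and e :: real
  assumes k: "integrable lborel k" and e: "e > 0"
  defines "G \<equiv> \<lambda>s. LINT u|lborel. k u * iexp (- (u * s))"
  shows "integrable lborel (\<lambda>x. (norm (G x))\<^sup>2 * exp (- (e * x)\<^sup>2 / 2))" (is ?I)
    and "complex_of_real (LINT x|lborel. (norm (G x))\<^sup>2 * exp (- (e * x)\<^sup>2 / 2)) =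
      2 * pi * (LINT u|lborel. k u * (LINT w|std_normal_distribution. cnj (k (u + e * w))))" (is ?E)
proof -
  have km[measurable]: "k \<in> borel_measurable borel"
    using borel_measurable_integrable[OF k] by simp
  have [measurable]: "cnj \<in> borel_measurable borel"
    by (intro borel_measurable_continuous_onI continuous_intros)
  interpret N: real_distribution std_normal_distribution by (rule real_dist_normal_dist)
  have Gm[measurable]: "G \<in> borel_measurable borel" unfolding G_def by measurable
  have Gs: "G s = (LINT u|lborel. k u * iexp (- (u * s)))" for s
    by (simp add: G_def)
  have Gb: "norm (G s) \<le> (LINT u|lborel. norm (k u))" for s
    unfolding G_def
    by (rule order_trans[OF integral_norm_bound]) (simp add: norm_mult)
  define B where "B = (LINT u|lborel. norm (k u))"
  have Gb2: "(norm (G s))\<^sup>2 \<le> B\<^sup>2" for s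
    using Gb[of s] unfolding B_def by (intro power_mono) auto
  have dens: "exp (- y\<^sup>2 / 2) = sqrt (2 * pi) * std_normal_density y" for y :: real
    by (simp add: std_normal_density_def field_simps)
  have gint: "integrable lborel (\<lambda>y. (norm (G (y / e)))\<^sup>2 * exp (- y\<^sup>2 / 2))"
    unfolding dens
  proof (rule Bochner_Integration.integrable_bound)
    show "integrable lborel (\<lambda>y. B\<^sup>2 * (sqrt (2 * pi) * std_normal_density y))" by simp
    show "AE x in lborel. norm ((norm (G (x / e)))\<^sup>2 * (sqrt (2 * pi) * std_normal_density x))
           \<le> norm (B\<^sup>2 * (sqrt (2 * pi) * std_normal_density x))"
      using Gb2 by (auto simp: abs_mult intro!: mult_right_mono)
  qed measurable
  have "integrable lborel (\<lambda>x. (norm (G ((0 + e * x) / e)))\<^sup>2 * exp (- (0 + e * x)\<^sup>2 / 2))"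
    using e by (intro lborel_integrable_real_affine[OF gint]) auto
  then show ?I using e by simp
  define J where "J = (LINT y|std_normal_distribution. (norm (G (y / e)))\<^sup>2)"
  have "(LINT y|lborel. (norm (G (y / e)))\<^sup>2 * exp (- y\<^sup>2 / 2)) =
     e * (LINT x|lborel. (norm (G x))\<^sup>2 * exp (- (e * x)\<^sup>2 / 2))"
    using e by (subst lborel_integral_real_affine[where c = e and t = 0]) auto
  moreover have "(LINT y|lborel. (norm (G (y / e)))\<^sup>2 * exp (- y\<^sup>2 / 2)) = sqrt (2 * pi) * J"
    unfolding J_def dens
    by (subst integral_density) (auto simp: mult.commute mult.left_commute simp flip: Bochner_Integration.integral_mult_right_zero)
  ultimately have LJ: "(LINT x|lborel. (norm (G x))\<^sup>2 * exp (- (e * x)\<^sup>2 / 2)) = sqrt (2 * pi) / e * J"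
    using e by (simp add: field_simps)
  have cnjG: "cnj (G s) = (LINT v|lborel. cnj (k v) * iexp (v * s))" for s
    unfolding G_def
    by (subst integral_bounded_linear'[OF bounded_linear_cnj bounded_linear_cnj, symmetric], simp, intro Bochner_Integration.integral_cong refl)
       (simp add: exp_cnj)
  have inner: "(LINT y|std_normal_distribution. cnj (G (y / e)) * iexp (- (u * (y / e)))) =
      e * sqrt (2 * pi) * (LINT w|std_normal_distribution. cnj (k (u + e * w)))" for u
  proof -
    have "(LINT y|std_normal_distribution. cnj (G (y / e)) * iexp (- (u * (y / e)))) =
       (LINT y|std_normal_distribution. iexp (- (u * (y / e))) * (LINT v|lborel. cnj (k v) * iexp (v * (y / e))))"
      by (simp add: cnjG mult.commute)
    also have "\<dots> = (LINT v|lborel. cnj (k v) * (LINT y|std_normal_distribution. iexp (- (u * (y / e))) * iexp (v * (y / e))))"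
    proof (rule Fubini_bounded_kernel)
      show "sigma_finite_measure std_normal_distribution" by (rule N.sigma_finite_measure_axioms)
      show "integrable std_normal_distribution (\<lambda>y. iexp (- (u * (y / e))))"
        by (rule N.integrable_const_bound[where B=1]) auto
      show "integrable lborel (\<lambda>v. cnj (k v))" using k by simp
    qed (auto intro: sigma_finite_lborel)
    also have "\<dots> = (LINT v|lborel. cnj (k v) * of_real (exp (- ((v - u) / e)\<^sup>2 / 2)))"
    proof (intro Bochner_Integration.integral_cong refl arg_cong2[where f="(*)"])
      fix v
      have "(LINT y|std_normal_distribution. iexp (- (u * (y / e))) * iexp (v * (y / e))) =
        char std_normal_distribution ((v - u) / e)"
        unfolding char_def
        by (intro Bochner_Integration.integral_cong refl)
           (simp add: exp_add[symmetric] algebra_simps diff_divide_distrib)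
      then show "(LINT y|std_normal_distribution. iexp (- (u * (y / e))) * iexp (v * (y / e))) =
        of_real (exp (- ((v - u) / e)\<^sup>2 / 2))"
        by (simp add: char_std_normal_distribution)
    qed
    also have "\<dots> = e * (LINT w|lborel. cnj (k (u + e * w)) * of_real (exp (- w\<^sup>2 / 2)))"
      using e by (subst lborel_integral_real_affine[where c = e and t = u]) (auto simp: scaleR_conv_of_real)
    also have "(LINT w|lborel. cnj (k (u + e * w)) * of_real (exp (- w\<^sup>2 / 2))) =
       sqrt (2 * pi) * (LINT w|std_normal_distribution. cnj (k (u + e * w)))"
      unfolding dens
      by (subst integral_density)
         (auto simp: scaleR_conv_of_real mult.commute mult.left_commute simp flip: Bochner_Integration.integral_mult_right_zero)
    finally show ?thesis by simp
  qed
  have "complex_of_real J = (LINT y|std_normal_distribution. of_real ((norm (G (y / e)))\<^sup>2))"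
    unfolding J_def by (rule integral_complex_of_real[symmetric])
  also have "\<dots> = (LINT y|std_normal_distribution. cnj (G (y / e)) * (LINT u|lborel. k u * iexp (- (u * (y / e)))))"
    unfolding Gs[symmetric]
    by (intro Bochner_Integration.integral_cong refl) (metis complex_norm_square mult.commute)
  also have "\<dots> = (LINT u|lborel. k u * (LINT y|std_normal_distribution. cnj (G (y / e)) * iexp (- (u * (y / e)))))"
  proof (rule Fubini_bounded_kernel)
    show "sigma_finite_measure std_normal_distribution" by (rule N.sigma_finite_measure_axioms)
    show "integrable std_normal_distribution (\<lambda>y. cnj (G (y / e)))"
      using Gb by (intro N.integrable_const_bound[where B=B]) (auto simp: B_def)
  qed (auto intro: sigma_finite_lborel k)
  also have "\<dots> = e * sqrt (2 * pi) * (LINT u|lborel. k u * (LINT w|std_normal_distribution. cnj (k (u + e * w))))"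
    unfolding inner by (simp add: mult.left_commute flip: Bochner_Integration.integral_mult_right_zero)
  finally have J: "complex_of_real J = \<dots>" .
  have s: "complex_of_real (sqrt (2 * pi)) * complex_of_real (sqrt (2 * pi)) = 2 * pi"
    by (simp flip: of_real_mult)
  have "complex_of_real (LINT x|lborel. (norm (G x))\<^sup>2 * exp (- (e * x)\<^sup>2 / 2)) = of_real (sqrt (2 * pi) / e) * complex_of_real J"
    unfolding LJ by (simp only: of_real_mult)
  also have "\<dots> = (complex_of_real (sqrt (2 * pi)) * complex_of_real (sqrt (2 * pi))) * (LINT u|lborel. k u * (LINT w|std_normal_distribution. cnj (k (u + e * w))))"
    unfolding J using e by (simp del: of_real_sqrt)
  finally show ?E unfolding s by simp
qed

text \<open>Let the damping of \<open>gaussian_damped_energy\<close> disappear: the left-hand sides increase to the energy of \<open>G\<close>,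
  and on the right the normal averages of translates converge to the value of the function wherever it is
  continuous, that is, off the two endpoints.\<close>
lemma plancherel_band_limited:
  fixes g :: "real \<Rightarrow> complex" and a b :: real
  assumes g: "continuous_on {a..b} g"
  defines "G \<equiv> \<lambda>s. LBINT u:{a..b}. iexp (- (u * s)) * g u"
  shows "(\<integral>\<^sup>+ s. ennreal ((norm (G s))\<^sup>2) \<partial>lborel) = ennreal (2 * pi * (LBINT u:{a..b}. (norm (g u))\<^sup>2))"
proof -
  interpret N: real_distribution std_normal_distribution by (rule real_dist_normal_dist)
  define k where "k u = indicator {a..b} u *\<^sub>R g u" for u
  have k: "integrable lborel k"
    using borel_integrable_atLeastAtMost'[OF g] by (simp add: set_integrable_def k_def[abs_def])
  have km[measurable]: "k \<in> borel_measurable borel"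
    using borel_measurable_integrable[OF k] by simp
  have [measurable]: "cnj \<in> borel_measurable borel"
    by (intro borel_measurable_continuous_onI continuous_intros)
  have "bounded (g ` {a..b})"
    by (intro compact_imp_bounded compact_continuous_image g) simp
  then obtain B where B: "B > 0" "\<And>u. u \<in> {a..b} \<Longrightarrow> norm (g u) \<le> B"
    unfolding bounded_pos by auto
  have kB: "norm (k u) \<le> B" for u
    using B by (auto simp: k_def indicator_def)
  have G: "G s = (LINT u|lborel. k u * iexp (- (u * s)))" for s
    unfolding G_def set_lebesgue_integral_def k_def
    by (intro Bochner_Integration.integral_cong refl) (simp add: mult.commute scaleR_conv_of_real mult.left_commute)
  have Gm[measurable]: "G \<in> borel_measurable borel"
    unfolding G[abs_def] by measurable
  define e :: "nat \<Rightarrow> real" where "e j = 1 / (real j + 1)" for j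
  have e0: "e j > 0" for j by (simp add: e_def)
  have elim: "e \<longlonglongrightarrow> 0"
    unfolding e_def by real_asymp
  define I where "I j = (LINT x|lborel. (norm (G x))\<^sup>2 * exp (- (e j * x)\<^sup>2 / 2))" for j
  define R where "R j = (LINT u|lborel. k u * (LINT w|std_normal_distribution. cnj (k (u + e j * w))))" for j
  have IR: "complex_of_real (I j) = 2 * pi * R j" for j
    unfolding I_def R_def G by (rule gaussian_damped_energy(2)[OF k e0])
  have Iint: "integrable lborel (\<lambda>x. (norm (G x))\<^sup>2 * exp (- (e j * x)\<^sup>2 / 2))" for j
    unfolding G by (rule gaussian_damped_energy(1)[OF k e0])
  \<comment> \<open>The extension by zero jumps at the endpoints at most, which is invisible to the outer integral.\<close>
  have kcont: "isCont k u" if "u \<noteq> a" "u \<noteq> b" for u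
  proof (cases "u \<in> {a..b}")
    case True
    with that have u: "u \<in> {a<..<b}" by auto
    have "isCont g u"
      using continuous_on_interior[OF g] u by simp
    moreover have "eventually (\<lambda>v. k v = g v) (nhds u)"
      using eventually_nhds_in_open[OF open_greaterThanLessThan u]
      by eventually_elim (auto simp: k_def)
    ultimately show ?thesis using isCont_cong by blast
  next
    case False
    then have u: "u \<in> - {a..b}" by auto
    have "eventually (\<lambda>v. k v = 0) (nhds u)"
      using eventually_nhds_in_open[OF _ u] by (rule eventually_mono) (auto simp: k_def open_Compl)
    then show ?thesis using isCont_cong[of k "\<lambda>_. 0" u] by simp
  qed
  have smooth: "(\<lambda>j. LINT w|std_normal_distribution. cnj (k (u + e j * w))) \<longlonglongrightarrow> cnj (k u)"
    if u: "u \<noteq> a" "u \<noteq> b" for u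
  proof -
    have "(\<lambda>j. LINT w|std_normal_distribution. cnj (k (u + e j * w))) \<longlonglongrightarrow> (LINT w|std_normal_distribution. cnj (k u))"
    proof (rule integral_dominated_convergence[where w = "\<lambda>_. B"])
      show "AE w in std_normal_distribution. (\<lambda>j. cnj (k (u + e j * w))) \<longlonglongrightarrow> cnj (k u)"
      proof (rule AE_I2)
        fix w :: real
        have "(\<lambda>j. u + e j * w) \<longlonglongrightarrow> u + 0 * w"
          by (intro tendsto_intros elim)
        then show "(\<lambda>j. cnj (k (u + e j * w))) \<longlonglongrightarrow> cnj (k u)"
          by (intro tendsto_cnj isCont_tendsto_compose[OF kcont[OF u]]) simp
      qed
    qed (use kB in auto)
    then show ?thesis using N.prob_space by simp
  qed
  have "R \<longlonglongrightarrow> (LINT u|lborel. k u * cnj (k u))"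
    unfolding R_def
  proof (rule integral_dominated_convergence[where w = "\<lambda>u. norm (k u) * B"])
    show "AE u in lborel. (\<lambda>j. k u * (LINT w|std_normal_distribution. cnj (k (u + e j * w)))) \<longlonglongrightarrow> k u * cnj (k u)"
      using AE_lborel_singleton[of a] AE_lborel_singleton[of b]
      by eventually_elim (intro tendsto_intros smooth)
    show "AE u in lborel. norm (k u * (LINT w|std_normal_distribution. cnj (k (u + e j * w)))) \<le> norm (k u) * B" for j
    proof (rule AE_I2)
      fix u
      have "norm (LINT w|std_normal_distribution. cnj (k (u + e j * w))) \<le> B"
        by (rule order_trans[OF integral_norm_bound], rule N.integral_le_const)
           (use kB in \<open>auto intro!: N.integrable_const_bound[where B=B]\<close>)
      then show "norm (k u * (LINT w|std_normal_distribution. cnj (k (u + e j * w)))) \<le> norm (k u) * B"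
        by (simp add: norm_mult mult_left_mono N.prob_space)
    qed
  qed (use k in auto)
  then have "(\<lambda>j. complex_of_real (I j)) \<longlonglongrightarrow> 2 * pi * (LINT u|lborel. k u * cnj (k u))"
    unfolding IR by (intro tendsto_intros)
  also have "(LINT u|lborel. k u * cnj (k u)) = complex_of_real (LBINT u:{a..b}. (norm (g u))\<^sup>2)"
    unfolding set_lebesgue_integral_def
    by (subst integral_complex_of_real[symmetric], intro Bochner_Integration.integral_cong refl)
       (simp add: k_def indicator_def complex_norm_square[symmetric])
  finally have "(\<lambda>j. complex_of_real (I j)) \<longlonglongrightarrow> complex_of_real (2 * pi * (LBINT u:{a..b}. (norm (g u))\<^sup>2))"
    by simp
  then have "I \<longlonglongrightarrow> 2 * pi * (LBINT u:{a..b}. (norm (g u))\<^sup>2)"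
    by (simp only: tendsto_of_real_iff)
  then have lim1: "(\<lambda>j. ennreal (I j)) \<longlonglongrightarrow> ennreal (2 * pi * (LBINT u:{a..b}. (norm (g u))\<^sup>2))"
    by (rule tendsto_ennrealI)
  have "(\<lambda>j. \<integral>\<^sup>+ x. ennreal ((norm (G x))\<^sup>2 * exp (- (e j * x)\<^sup>2 / 2)) \<partial>lborel) \<longlonglongrightarrow>
     (\<integral>\<^sup>+ x. ennreal ((norm (G x))\<^sup>2) \<partial>lborel)"
  proof (rule nn_integral_LIMSEQ)
    show "incseq (\<lambda>j x. ennreal ((norm (G x))\<^sup>2 * exp (- (e j * x)\<^sup>2 / 2)))"
    proof (intro incseq_SucI le_funI ennreal_leI mult_left_mono)
      fix j x
      have "e (Suc j) \<le> e j" by (simp add: e_def frac_le)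
      then have "(e (Suc j))\<^sup>2 \<le> (e j)\<^sup>2" using e0[of "Suc j"] by (intro power_mono) auto
      then show "exp (- (e j * x)\<^sup>2 / 2) \<le> exp (- (e (Suc j) * x)\<^sup>2 / 2)"
        by (simp add: power_mult_distrib mult_right_mono)
    qed simp
    show "(\<lambda>j. ennreal ((norm (G x))\<^sup>2 * exp (- (e j * x)\<^sup>2 / 2))) \<longlonglongrightarrow> ennreal ((norm (G x))\<^sup>2)" for x
    proof (rule tendsto_ennrealI)
      have "(\<lambda>j. (norm (G x))\<^sup>2 * exp (- (e j * x)\<^sup>2 / 2)) \<longlonglongrightarrow> (norm (G x))\<^sup>2 * exp (- (0 * x)\<^sup>2 / 2)"
        by (intro tendsto_intros elim) simp
      then show "(\<lambda>j. (norm (G x))\<^sup>2 * exp (- (e j * x)\<^sup>2 / 2)) \<longlonglongrightarrow> (norm (G x))\<^sup>2" by simp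
    qed
  qed measurable
  moreover have "(\<integral>\<^sup>+ x. ennreal ((norm (G x))\<^sup>2 * exp (- (e j * x)\<^sup>2 / 2)) \<partial>lborel) = ennreal (I j)" for j
    unfolding I_def by (rule nn_integral_eq_integral[OF Iint]) simp
  ultimately show ?thesis
    using lim1 LIMSEQ_unique by simp
qed

lemma integrable_inner_of_squares:
  fixes f g :: "'b \<Rightarrow> complex"
  assumes [measurable]: "f \<in> borel_measurable N" "g \<in> borel_measurable N"
    and "integrable N (\<lambda>x. (norm (f x))\<^sup>2)" "integrable N (\<lambda>x. (norm (g x))\<^sup>2)"
  shows "integrable N (\<lambda>x. f x \<bullet> g x)"
proof (rule Bochner_Integration.integrable_bound)
  show "integrable N (\<lambda>x. (norm (f x))\<^sup>2 + (norm (g x))\<^sup>2)"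
    using assms by simp
  have "\<bar>f x \<bullet> g x\<bar> \<le> (norm (f x))\<^sup>2 + (norm (g x))\<^sup>2" for x
  proof -
    have "\<bar>f x \<bullet> g x\<bar> \<le> norm (f x) * norm (g x)" by (rule Cauchy_Schwarz_ineq2)
    moreover have "2 * (norm (f x) * norm (g x)) \<le> (norm (f x))\<^sup>2 + (norm (g x))\<^sup>2"
      using sum_squares_bound[of "norm (f x)" "norm (g x)"] by (simp add: mult.assoc)
    ultimately show ?thesis using mult_nonneg_nonneg[of "norm (f x)" "norm (g x)"] by linarith
  qed
  then show "AE x in N. norm (f x \<bullet> g x) \<le> norm ((norm (f x))\<^sup>2 + (norm (g x))\<^sup>2)"
    by (intro AE_I2) simp
qed measurable

context
  fixes m :: real
begin

abbreviation "band \<equiv> {- (pi * m)..pi * m}"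

lemma truncated_transform_measurable:
  assumes g: "continuous_on band g"
  shows "(\<lambda>x. LBINT u:band. iexp (- (u * x)) * g u) \<in> borel_measurable borel"
proof -
  have k: "set_integrable lborel band g"
    by (rule borel_integrable_atLeastAtMost'[OF g])
  have [measurable]: "(\<lambda>u. indicator band u *\<^sub>R g u) \<in> borel_measurable borel"
    using borel_measurable_integrable[OF k[unfolded set_integrable_def]] by simp
  have eq: "(LBINT u:band. iexp (- (u * x)) * g u) = (LINT u|lborel. iexp (- (u * x)) * (indicator band u *\<^sub>R g u))" for x
    unfolding set_lebesgue_integral_def by (simp add: scaleR_conv_of_real mult_ac)
  show ?thesis
    unfolding eq by measurable
qed

lemma spectral_cutoff_measurable:
  assumes g: "continuous_on band g"
  shows "spectral_cutoff g m \<in> borel_measurable borel"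
  unfolding spectral_cutoff_def[abs_def]
  by (intro borel_measurable_times borel_measurable_const truncated_transform_measurable g)

lemma spectral_cutoff_energy:
  assumes g: "continuous_on band g"
  shows "integrable lborel (\<lambda>x. (norm (spectral_cutoff g m x))\<^sup>2)"
    and "(LINT x|lborel. (norm (spectral_cutoff g m x))\<^sup>2) = 1 / (2 * pi) * (LBINT u:band. (norm (g u))\<^sup>2)"
proof -
  note [measurable] = spectral_cutoff_measurable[OF g] truncated_transform_measurable[OF g]
  have nonneg: "0 \<le> 1 / (2 * pi) * (LBINT u:band. (norm (g u))\<^sup>2)"
    by (auto intro!: divide_nonneg_nonneg integral_nonneg_AE simp: set_lebesgue_integral_def)
  have "(\<integral>\<^sup>+ x. ennreal ((norm (spectral_cutoff g m x))\<^sup>2) \<partial>lborel) =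
     (\<integral>\<^sup>+ x. ennreal (1 / (4 * pi\<^sup>2)) * ennreal ((norm (LBINT u:band. iexp (- (u * x)) * g u))\<^sup>2) \<partial>lborel)"
    unfolding spectral_cutoff_def
    by (intro nn_integral_cong) (simp add: norm_mult power_mult_distrib norm_divide power_divide ennreal_mult'[symmetric])
  also have "\<dots> = ennreal (1 / (4 * pi\<^sup>2)) * (\<integral>\<^sup>+ x. ennreal ((norm (LBINT u:band. iexp (- (u * x)) * g u))\<^sup>2) \<partial>lborel)"
    by (rule nn_integral_cmult) measurable
  also have "\<dots> = ennreal (1 / (2 * pi) * (LBINT u:band. (norm (g u))\<^sup>2))"
    unfolding plancherel_band_limited[OF g]
    by (subst ennreal_mult'[symmetric]) (simp_all add: power2_eq_square field_simps)
  finally have nn: "(\<integral>\<^sup>+ x. ennreal ((norm (spectral_cutoff g m x))\<^sup>2) \<partial>lborel) =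
     ennreal (1 / (2 * pi) * (LBINT u:band. (norm (g u))\<^sup>2))" .
  show int: "integrable lborel (\<lambda>x. (norm (spectral_cutoff g m x))\<^sup>2)"
    by (rule integrableI_nn_integral_finite[OF _ _ nn]) auto
  show "(LINT x|lborel. (norm (spectral_cutoff g m x))\<^sup>2) = 1 / (2 * pi) * (LBINT u:band. (norm (g u))\<^sup>2)"
    using nn nonneg by (subst (asm) nn_integral_eq_integral[OF int]) (auto simp: ennreal_inj)
qed

lemma spectral_cutoff_add:
  assumes "continuous_on band f" "continuous_on band g"
  shows "spectral_cutoff (\<lambda>u. f u + g u) m x = spectral_cutoff f m x + spectral_cutoff g m x"
proof -
  have "set_integrable lborel band (\<lambda>u. iexp (- (u * x)) * f u)" "set_integrable lborel band (\<lambda>u. iexp (- (u * x)) * g u)"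
    by (intro borel_integrable_atLeastAtMost' continuous_intros assms)+
  then show ?thesis
    unfolding spectral_cutoff_def by (simp add: distrib_left)
qed

text \<open>Polarisation of the energy identity.\<close>
lemma spectral_cutoff_inner:
  assumes f: "continuous_on band f" and g: "continuous_on band g"
  shows "(LINT x|lborel. spectral_cutoff f m x \<bullet> spectral_cutoff g m x) =
      1 / (2 * pi) * (LBINT u:band. f u \<bullet> g u)"
proof -
  have fg: "continuous_on band (\<lambda>u. f u + g u)" by (intro continuous_intros f g)
  have e: "set_integrable lborel band (\<lambda>u. (norm (f u))\<^sup>2)" "set_integrable lborel band (\<lambda>u. (norm (g u))\<^sup>2)"
    "set_integrable lborel band (\<lambda>u. (norm (f u + g u))\<^sup>2)"
    by (intro borel_integrable_atLeastAtMost' continuous_intros f g)+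
  have "(LINT x|lborel. spectral_cutoff f m x \<bullet> spectral_cutoff g m x) =
    (LINT x|lborel. ((norm (spectral_cutoff (\<lambda>u. f u + g u) m x))\<^sup>2 - (norm (spectral_cutoff f m x))\<^sup>2 - (norm (spectral_cutoff g m x))\<^sup>2) / 2)"
    by (simp add: dot_norm spectral_cutoff_add[OF f g])
  also have "\<dots> = (1 / (2 * pi) * (LBINT u:band. (norm (f u + g u))\<^sup>2) - 1 / (2 * pi) * (LBINT u:band. (norm (f u))\<^sup>2)
      - 1 / (2 * pi) * (LBINT u:band. (norm (g u))\<^sup>2)) / 2"
    using spectral_cutoff_energy[OF f] spectral_cutoff_energy[OF g] spectral_cutoff_energy[OF fg] by simp
  also have "\<dots> = 1 / (2 * pi) * (LBINT u:band. ((norm (f u + g u))\<^sup>2 - (norm (f u))\<^sup>2 - (norm (g u))\<^sup>2) / 2)"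
    using e by (simp add: set_integral_diff right_diff_distrib diff_divide_distrib)
  also have "\<dots> = 1 / (2 * pi) * (LBINT u:band. f u \<bullet> g u)"
    by (simp add: dot_norm)
  finally show ?thesis .
qed

text \<open>Here \<open>h\<close> need not be band limited: the transform is moved onto \<open>h\<close> by Fubini, and only the values of \<open>h\<^sup>*\<close>
  on the band enter. Together with the previous lemma this says that
  \<open>h\<close> and its own cutoff have the same inner product with every cutoff.\<close>
lemma spectral_cutoff_inner_integrable:
  assumes f: "continuous_on band f" and h: "integrable lborel h"
  shows "(LINT x|lborel. spectral_cutoff f m x \<bullet> complex_of_real (h x)) =
      1 / (2 * pi) * (LBINT u:band. f u \<bullet> fourier h u)"
proof -
  define k where "k u = indicator band u *\<^sub>R f u" for u
  have k: "integrable lborel k"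
    using borel_integrable_atLeastAtMost'[OF f] by (simp add: set_integrable_def k_def[abs_def])
  note [measurable] = borel_measurable_integrable[OF h]
  have hc: "integrable lborel (\<lambda>x. complex_of_real (h x))" using h by simp
  have kh: "integrable lborel (\<lambda>u. k u * cnj (fourier h u))"
  proof -
    have "set_integrable lborel band (\<lambda>u. f u * cnj (fourier h u))"
      by (intro borel_integrable_atLeastAtMost' continuous_intros f continuous_on_fourier h)
    then show ?thesis by (simp add: set_integrable_def k_def)
  qed
  have cut: "spectral_cutoff f m x = of_real (1 / (2 * pi)) * (LINT u|lborel. k u * iexp (- (u * x)))" for x
    unfolding spectral_cutoff_def set_lebesgue_integral_def k_def by (simp add: scaleR_conv_of_real mult_ac)
  have cutb: "norm (spectral_cutoff f m x) \<le> 1 / (2 * pi) * (LINT u|lborel. norm (k u))" for x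
    unfolding cut norm_mult
    by (intro mult_mono order_trans[OF integral_norm_bound]) (auto simp: norm_mult norm_divide)
  have fourier_cnj: "cnj (fourier h u) = (LINT x|lborel. complex_of_real (h x) * iexp (- (u * x)))" for u
    unfolding fourier_def
    by (subst integral_bounded_linear'[OF bounded_linear_cnj bounded_linear_cnj, symmetric], simp,
        intro Bochner_Integration.integral_cong refl)
       (simp add: exp_cnj mult.commute)
  have int: "integrable lborel (\<lambda>x. spectral_cutoff f m x * complex_of_real (h x))"
  proof (rule Bochner_Integration.integrable_bound)
    show "integrable lborel (\<lambda>x. 1 / (2 * pi) * (LINT u|lborel. norm (k u)) * norm (h x))" using h by simp
    show "AE x in lborel. norm (spectral_cutoff f m x * complex_of_real (h x))
        \<le> norm (1 / (2 * pi) * (LINT u|lborel. norm (k u)) * norm (h x))"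
    proof (rule AE_I2)
      fix x
      show "norm (spectral_cutoff f m x * complex_of_real (h x))
        \<le> norm (1 / (2 * pi) * (LINT u|lborel. norm (k u)) * norm (h x))"
        using mult_right_mono[OF cutb[of x] abs_ge_zero[of "h x"]] by (simp add: norm_mult abs_mult)
    qed
    have [measurable]: "spectral_cutoff f m \<in> borel_measurable borel" by (rule spectral_cutoff_measurable[OF f])
    show "(\<lambda>x. spectral_cutoff f m x * complex_of_real (h x)) \<in> borel_measurable lborel" by measurable
  qed
  have Re_mult: "Re (of_real c * z) = c * Re z" for c z by simp
  have "(LINT x|lborel. spectral_cutoff f m x \<bullet> complex_of_real (h x)) =
     (LINT x|lborel. Re (spectral_cutoff f m x * complex_of_real (h x)))"
    by (simp add: inner_complex_def)
  also have "\<dots> = Re (LINT x|lborel. spectral_cutoff f m x * complex_of_real (h x))"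
    by (rule integral_Re[OF int])
  also have "(LINT x|lborel. spectral_cutoff f m x * complex_of_real (h x)) =
     of_real (1 / (2 * pi)) * (LINT x|lborel. complex_of_real (h x) * (LINT u|lborel. k u * iexp (- (u * x))))"
    unfolding cut by (simp add: mult_ac flip: Bochner_Integration.integral_mult_right_zero)
  also have "(LINT x|lborel. complex_of_real (h x) * (LINT u|lborel. k u * iexp (- (u * x)))) =
     (LINT u|lborel. k u * (LINT x|lborel. complex_of_real (h x) * iexp (- (u * x))))"
    by (rule Fubini_bounded_kernel) (auto intro: sigma_finite_lborel k hc)
  also have "\<dots> = (LINT u|lborel. k u * cnj (fourier h u))"
    unfolding fourier_cnj ..
  also have "Re (of_real (1 / (2 * pi)) * (LINT u|lborel. k u * cnj (fourier h u))) = 1 / (2 * pi) * Re (LINT u|lborel. k u * cnj (fourier h u))"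
    by (rule Re_mult)
  also have "Re (LINT u|lborel. k u * cnj (fourier h u)) = (LINT u|lborel. Re (k u * cnj (fourier h u)))"
    by (rule integral_Re[OF kh, symmetric])
  also have "\<dots> = (LBINT u:band. f u \<bullet> fourier h u)"
    unfolding set_lebesgue_integral_def k_def
    by (intro Bochner_Integration.integral_cong refl) (simp add: inner_complex_def algebra_simps)
  finally show ?thesis .
qed

text \<open>Pythagoras: the cutoff of \<open>g - h\<^sup>*\<close> is orthogonal to \<open>h\<^sub>m - h\<close>.\<close>
lemma L2_norm_sq_cutoff_decomposition:
  assumes g: "continuous_on band g" and h: "integrable lborel h" and h2: "integrable lborel (\<lambda>x. (h x)\<^sup>2)"
  shows "L2_norm_sq (\<lambda>x. spectral_cutoff g m x - of_real (h x)) =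
    L2_norm_sq (\<lambda>x. h_cutoff h m x - of_real (h x))
      + ennreal (1 / (2 * pi) * (LBINT u:band. (norm (g u - fourier h u))\<^sup>2))"
proof -
  note hstar = continuous_on_fourier[OF h, of band]
  define d where "d u = g u - fourier h u" for u
  have d: "continuous_on band d" unfolding d_def by (intro continuous_intros g hstar)
  let ?D = "spectral_cutoff d m" and ?P = "spectral_cutoff (fourier h) m" and ?h = "\<lambda>x. complex_of_real (h x)"
  have [measurable]: "?D \<in> borel_measurable borel" "?P \<in> borel_measurable borel" "h \<in> borel_measurable borel"
    using spectral_cutoff_measurable[OF d] spectral_cutoff_measurable[OF hstar] borel_measurable_integrable[OF h] by auto
  have split: "spectral_cutoff g m x = ?D x + ?P x" for x
    using spectral_cutoff_add[OF d hstar, of x] by (simp add: d_def)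
  have iD: "integrable lborel (\<lambda>x. (norm (?D x))\<^sup>2)" and iP: "integrable lborel (\<lambda>x. (norm (?P x))\<^sup>2)"
    using spectral_cutoff_energy[OF d] spectral_cutoff_energy[OF hstar] by auto
  have ih: "integrable lborel (\<lambda>x. (norm (?h x))\<^sup>2)" using h2 by simp
  have iDP: "integrable lborel (\<lambda>x. ?D x \<bullet> ?P x)" and iDh: "integrable lborel (\<lambda>x. ?D x \<bullet> ?h x)"
    and iPh: "integrable lborel (\<lambda>x. ?P x \<bullet> ?h x)"
    by (rule integrable_inner_of_squares; (fact iD iP ih | measurable))+
  have sq: "(norm (x - y))\<^sup>2 = (norm x)\<^sup>2 + (norm y)\<^sup>2 - 2 * (x \<bullet> y)" for x y :: complex
    by (simp add: power2_norm_eq_inner inner_diff_left inner_diff_right inner_commute)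
  have iPmh: "integrable lborel (\<lambda>x. (norm (?P x - ?h x))\<^sup>2)"
    unfolding sq using iP ih iPh by (intro Bochner_Integration.integrable_diff Bochner_Integration.integrable_add integrable_mult_right)
  have pt: "(norm (spectral_cutoff g m x - ?h x))\<^sup>2 =
      (norm (?P x - ?h x))\<^sup>2 + (norm (?D x))\<^sup>2 + 2 * (?D x \<bullet> ?P x - ?D x \<bullet> ?h x)" for x
    unfolding split by (simp add: power2_norm_eq_inner inner_diff_left inner_diff_right inner_add_left inner_add_right inner_commute algebra_simps)
  have iall: "integrable lborel (\<lambda>x. (norm (spectral_cutoff g m x - ?h x))\<^sup>2)"
    unfolding pt using iPmh iD iDP iDh
    by (intro Bochner_Integration.integrable_diff Bochner_Integration.integrable_add integrable_mult_right)
  have "(LINT x|lborel. (norm (spectral_cutoff g m x - ?h x))\<^sup>2) =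
     (LINT x|lborel. (norm (?P x - ?h x))\<^sup>2) + (LINT x|lborel. (norm (?D x))\<^sup>2)
       + 2 * ((LINT x|lborel. ?D x \<bullet> ?P x) - (LINT x|lborel. ?D x \<bullet> ?h x))"
    unfolding pt using iPmh iD iDP iDh by simp
  also have "\<dots> = (LINT x|lborel. (norm (?P x - ?h x))\<^sup>2) + 1 / (2 * pi) * (LBINT u:band. (norm (d u))\<^sup>2)"
    using spectral_cutoff_inner[OF d hstar] spectral_cutoff_inner_integrable[OF d h] spectral_cutoff_energy(2)[OF d] by simp
  finally have main: "(LINT x|lborel. (norm (spectral_cutoff g m x - ?h x))\<^sup>2) = \<dots>" .
  have nonneg: "0 \<le> 1 / (2 * pi) * (LBINT u:band. (norm (d u))\<^sup>2)"
    by (auto intro!: divide_nonneg_nonneg integral_nonneg_AE simp: set_lebesgue_integral_def)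
  have "L2_norm_sq (\<lambda>x. spectral_cutoff g m x - ?h x) = ennreal (LINT x|lborel. (norm (spectral_cutoff g m x - ?h x))\<^sup>2)"
    unfolding L2_norm_sq_def by (rule nn_integral_eq_integral[OF iall]) simp
  also have "\<dots> = ennreal (LINT x|lborel. (norm (?P x - ?h x))\<^sup>2) + ennreal (1 / (2 * pi) * (LBINT u:band. (norm (d u))\<^sup>2))"
    unfolding main using nonneg by (intro ennreal_plus) auto
  also have "ennreal (LINT x|lborel. (norm (?P x - ?h x))\<^sup>2) = L2_norm_sq (\<lambda>x. h_cutoff h m x - ?h x)"
    unfolding L2_norm_sq_def h_cutoff_def by (rule nn_integral_eq_integral[OF iPmh, symmetric]) simp
  finally show ?thesis by (simp add: d_def)
qed

end

section \<open>Moments from the smoothness of a characteristic function\<close>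

text \<open>Two applications of the mean value inequality, first to \<open>f1\<close> on \<open>[-t, t]\<close> and then to
  \<open>f t + f (- t)\<close> on \<open>[0, u]\<close>.\<close>
lemma second_difference_bound:
  fixes f f1 f2 :: "real \<Rightarrow> complex"
  assumes f: "\<And>u. (f has_vector_derivative f1 u) (at u)" and f1: "\<And>u. (f1 has_vector_derivative f2 u) (at u)"
    and f2: "\<And>u. isCont f2 u"
  obtains K where "\<And>u. 0 < u \<Longrightarrow> u \<le> 1 \<Longrightarrow> norm (f u + f (- u) - 2 * f 0) \<le> K * u\<^sup>2"
proof -
  have "bounded (f2 ` {-1..1})"
    by (intro compact_imp_bounded compact_continuous_image continuous_at_imp_continuous_on ballI f2) simp
  then obtain B where B: "B > 0" "\<And>u. u \<in> {-1..1} \<Longrightarrow> norm (f2 u) \<le> B"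
    unfolding bounded_pos by blast
  have lip1: "norm (f1 t - f1 (- t)) \<le> 2 * B * t" if "0 \<le> t" "t \<le> 1" for t
  proof -
    have "norm (f1 t - f1 (- t)) \<le> B * \<bar>t - (- t)\<bar>"
    proof (rule norm_diff_le_of_vector_derivative[where S = "{-1..1}" and f' = f2])
      show "(f1 has_vector_derivative f2 s) (at s within {-1..1})" for s
        by (rule has_vector_derivative_at_within[OF f1])
      show "norm (f2 s) \<le> B" if "s \<in> {-1..1}" for s by (rule B(2)[OF that])
      show "t \<in> {-1..1}" "- t \<in> {-1..1}" using that by simp_all
    qed simp
    then show ?thesis using that by simp
  qed
  have neg: "((\<lambda>t. f (- t)) has_vector_derivative - f1 (- t)) (at t)" for t
  proof -
    have d: "((\<lambda>t. - t) has_derivative (\<lambda>h. - h)) (at t)" by (intro derivative_intros)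
    have g: "(f has_derivative (\<lambda>h. h *\<^sub>R f1 (- t))) (at (- t))" using f[of "- t"] unfolding has_vector_derivative_def .
    from has_derivative_compose[OF d g] show ?thesis unfolding has_vector_derivative_def by (simp only: scaleR_minus_left scaleR_minus_right)
  qed
  have "norm (f u + f (- u) - 2 * f 0) \<le> 2 * B * u\<^sup>2" if u: "0 < u" "u \<le> 1" for u
  proof -
    have "norm ((f u + f (- u)) - (f 0 + f (- 0))) \<le> (2 * B * u) * \<bar>u - 0\<bar>"
    proof (rule norm_diff_le_of_vector_derivative[where S = "{0..u}" and f = "\<lambda>t. f t + f (- t)" and f' = "\<lambda>t. f1 t - f1 (- t)"])
      show "((\<lambda>t. f t + f (- t)) has_vector_derivative f1 t - f1 (- t)) (at t within {0..u})" for t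
        using has_vector_derivative_at_within[OF has_vector_derivative_add[OF f neg]] by simp
      show "norm (f1 t - f1 (- t)) \<le> 2 * B * u" if t: "t \<in> {0..u}" for t
      proof -
        have "norm (f1 t - f1 (- t)) \<le> 2 * B * t" using t u by (intro lip1) simp_all
        also have "\<dots> \<le> 2 * B * u" using t B(1) by (intro mult_left_mono) simp_all
        finally show ?thesis .
      qed
    qed (use u in simp_all)
    moreover have "\<bar>u - 0\<bar> = u" using u by simp
    ultimately show ?thesis by (simp only: minus_zero mult_2 power2_eq_square mult.assoc)
  qed
  then show ?thesis by (rule that)
qed

text \<open>The symmetric second difference of \<open>f\<close> at \<open>0\<close> is \<open>- \<integral> (2 - 2 cos (u X)) w\<close>. It is of
  order \<open>u\<^sup>2\<close>, whereas \<open>(2 - 2 cos (u X)) / u\<^sup>2\<close> is nonnegative and tends to \<open>X\<^sup>2\<close>, so Fatou's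
  lemma bounds \<open>\<integral> X\<^sup>2 w\<close>.\<close>
lemma integrable_square_if_char_C2:
  fixes f1 f2 :: "real \<Rightarrow> complex" and w :: "'b \<Rightarrow> real"
  assumes X[measurable]: "X \<in> borel_measurable N" and w: "integrable N w" and w0: "\<And>x. w x \<ge> 0"
  defines "f \<equiv> \<lambda>u. LINT x|N. iexp (u * X x) * of_real (w x)"
  assumes f: "\<And>u. (f has_vector_derivative f1 u) (at u)" and f1: "\<And>u. (f1 has_vector_derivative f2 u) (at u)"
    and f2: "\<And>u. isCont f2 u"
  shows "integrable N (\<lambda>x. (X x)\<^sup>2 * w x)"
proof -
  note [measurable] = borel_measurable_integrable[OF w]
  obtain K where K: "\<And>u. 0 < u \<Longrightarrow> u \<le> 1 \<Longrightarrow> norm (f u + f (- u) - 2 * f 0) \<le> K * u\<^sup>2"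
    using second_difference_bound[OF f f1 f2] by metis
  have i1: "integrable N (\<lambda>x. iexp (u * X x) * of_real (w x))" for u
    using w by (intro integrable_iexp_mult X) simp
  have ic: "integrable N (\<lambda>x. (2 - 2 * cos (u * X x)) * w x)" for u
  proof (rule Bochner_Integration.integrable_bound[OF integrable_mult_right[OF w, of 4]])
    have "\<bar>2 - 2 * cos y\<bar> \<le> 4" for y :: real
      using cos_le_one[of y] cos_ge_minus_one[of y] by linarith
    from mult_right_mono[OF this abs_ge_zero]
    show "AE x in N. norm ((2 - 2 * cos (u * X x)) * w x) \<le> norm (4 * w x)"
      by (intro AE_I2) (simp add: abs_mult)
  qed measurable
  have dd: "(LINT x|N. (2 - 2 * cos (u * X x)) * w x) \<le> K * u\<^sup>2" if u: "0 < u" "u \<le> 1" for u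
  proof -
    have "f u + f (- u) - 2 * f 0 =
        (LINT x|N. iexp (u * X x) * of_real (w x) + iexp (- u * X x) * of_real (w x) - 2 * (iexp (0 * X x) * of_real (w x)))"
      unfolding f_def using i1[of u] i1[of "- u"] i1[of 0] by simp
    also have "\<dots> = (LINT x|N. complex_of_real (- ((2 - 2 * cos (u * X x)) * w x)))"
    proof (intro Bochner_Integration.integral_cong refl)
      fix x
      have "iexp (u * X x) + iexp (- u * X x) = 2 * of_real (cos (u * X x))"
        by (simp only: cis_conv_exp[symmetric]) (simp add: complex_eq_iff)
      moreover have alg: "(2 * complex_of_real c - 2) * of_real v = of_real (- ((2 - 2 * c) * v))" for c v
        by (simp add: left_diff_distrib)
      moreover have "iexp (u * X x) * of_real (w x) + iexp (- u * X x) * of_real (w x) - 2 * (iexp (0 * X x) * of_real (w x)) =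
        (iexp (u * X x) + iexp (- u * X x) - 2) * of_real (w x)"
        by (simp add: distrib_right left_diff_distrib)
      ultimately show "iexp (u * X x) * of_real (w x) + iexp (- u * X x) * of_real (w x) - 2 * (iexp (0 * X x) * of_real (w x)) =
        complex_of_real (- ((2 - 2 * cos (u * X x)) * w x))"
        by (simp only: alg)
    qed
    also have "\<dots> = - complex_of_real (LINT x|N. (2 - 2 * cos (u * X x)) * w x)"
      by (simp only: integral_complex_of_real integral_minus of_real_minus)
    finally have "norm (f u + f (- u) - 2 * f 0) = \<bar>LINT x|N. (2 - 2 * cos (u * X x)) * w x\<bar>"
      by simp
    with K[OF u] show ?thesis by linarith
  qed
  define q where "q j x = (2 - 2 * cos (1 / (real j + 1) * X x)) * w x * (real j + 1)\<^sup>2" for j x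
  have q0: "q j x \<ge> 0" for j x
    unfolding q_def using w0 by (intro mult_nonneg_nonneg) auto
  have qK: "(\<integral>\<^sup>+ x. ennreal (q j x) \<partial>N) \<le> ennreal K" for j
  proof -
    have "integrable N (q j)"
      unfolding q_def[abs_def] by (intro integrable_mult_left ic)
    then have "(\<integral>\<^sup>+ x. ennreal (q j x) \<partial>N) = ennreal (LINT x|N. q j x)"
      by (intro nn_integral_eq_integral AE_I2 q0)
    also have "(LINT x|N. q j x) = (LINT x|N. (2 - 2 * cos (1 / (real j + 1) * X x)) * w x) * (real j + 1)\<^sup>2"
      unfolding q_def by simp
    also have "\<dots> \<le> (K * (1 / (real j + 1))\<^sup>2) * (real j + 1)\<^sup>2"
      by (intro mult_right_mono dd) auto
    also have "\<dots> = K" by (simp add: field_simps)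
    finally show ?thesis by (auto intro: ennreal_leI)
  qed
  have qlim: "(\<lambda>j. q j x) \<longlonglongrightarrow> (X x)\<^sup>2 * w x" for x
  proof -
    have "(\<lambda>j. (2 - 2 * cos (1 / (real j + 1) * y)) * (real j + 1)\<^sup>2) \<longlonglongrightarrow> y\<^sup>2" for y :: real
    proof -
      have "(2 - 2 * cos (1 / (real j + 1) * y)) * (real j + 1)\<^sup>2 = y\<^sup>2 * (sinc (y / 2 * (1 / (real j + 1))))\<^sup>2" for j
      proof -
        define z where "z = y / 2 * (1 / (real j + 1))"
        have y: "y = 2 * z * (real j + 1)" and z: "1 / (real j + 1) * y = 2 * z"
          by (simp_all add: z_def field_simps)
        have "(2 - 2 * cos (2 * z)) * (real j + 1)\<^sup>2 = (2 * z * (real j + 1))\<^sup>2 * (sinc z)\<^sup>2"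
          by (simp add: cos_double_sin power_divide power_mult_distrib)
        then show ?thesis by (simp only: z y[symmetric] z_def[symmetric])
      qed
      moreover have "(\<lambda>j. y\<^sup>2 * (sinc (y / 2 * (1 / (real j + 1))))\<^sup>2) \<longlonglongrightarrow> y\<^sup>2 * (sinc (y / 2 * 0))\<^sup>2"
      proof (intro tendsto_mult tendsto_power tendsto_const)
        have "(\<lambda>j. y / 2 * (1 / (real j + 1))) \<longlonglongrightarrow> y / 2 * 0"
          by (intro tendsto_mult tendsto_const) real_asymp
        from isCont_tendsto_compose[where g = sinc, OF isCont_sinc this]
        show "(\<lambda>j. sinc (y / 2 * (1 / (real j + 1)))) \<longlonglongrightarrow> sinc (y / 2 * 0)" .
      qed
      ultimately show ?thesis by simp
    qed
    from tendsto_mult[OF this[of "X x"] tendsto_const[of "w x"]] show ?thesis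
      unfolding q_def by (simp only: mult.assoc mult.commute[of "w x"])
  qed
  have "(\<integral>\<^sup>+ x. ennreal ((X x)\<^sup>2 * w x) \<partial>N) = (\<integral>\<^sup>+ x. liminf (\<lambda>j. ennreal (q j x)) \<partial>N)"
    by (intro nn_integral_cong lim_imp_Liminf[symmetric] tendsto_ennrealI qlim) simp
  also have "\<dots> \<le> liminf (\<lambda>j. \<integral>\<^sup>+ x. ennreal (q j x) \<partial>N)"
    by (rule nn_integral_liminf) (simp add: q_def)
  also have "\<dots> \<le> ennreal K"
  proof -
    have "liminf (\<lambda>j. \<integral>\<^sup>+ x. ennreal (q j x) \<partial>N) \<le> liminf (\<lambda>j. ennreal K)"
      by (intro Liminf_mono always_eventually allI qK)
    then show ?thesis by (simp add: Liminf_const)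
  qed
  finally have "(\<integral>\<^sup>+ x. ennreal ((X x)\<^sup>2 * w x) \<partial>N) < \<infinity>"
    by (rule le_less_trans) simp
  then show ?thesis
    using w0 by (intro integrableI_nonneg) auto
qed

section \<open>Derivatives of the Levy exponent and of the characteristic function\<close>

text \<open>The jump part of the derivative of the Levy exponent. It is kept in this compensated form
  because \<open>x \<nu> x\<close> may fail to be integrable at the origin.\<close>
definition jump_drift :: "(real \<Rightarrow> real) \<Rightarrow> real \<Rightarrow> complex" where
  "jump_drift \<nu> u = (LINT x|lborel. \<i> * of_real x * (iexp (u * x) - 1) * of_real (\<nu> x))"

lemma norm_iexp_minus_one: "norm (iexp t - 1) \<le> \<bar>t\<bar>"
  using iexp_approx1[of t 0] by simp

lemma norm_iexp_minus_one_minus_linear: "norm (iexp t - 1 - \<i> * of_real t) \<le> t\<^sup>2"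
proof -
  have "norm (iexp t - 1 - \<i> * of_real t) \<le> t\<^sup>2 / 2"
    using iexp_approx1[of t 1] by (simp add: diff_diff_eq power2_eq_square)
  also have "\<dots> \<le> t\<^sup>2" by simp
  finally show ?thesis .
qed

context
  fixes \<nu> :: "real \<Rightarrow> real"
  assumes \<nu>[measurable]: "\<nu> \<in> borel_measurable borel"
    and second_moment: "integrable lborel (\<lambda>x. x\<^sup>2 * \<nu> x)"
begin

lemma integrable_levy_h: "integrable lborel (levy_h \<nu>)"
  using second_moment unfolding levy_h_def[abs_def] .

lemma levy_exponent_has_jump_drift:
  "(levy_exponent b 0 \<nu> has_vector_derivative \<i> * of_real b + jump_drift \<nu> u) (at u)"
proof -
  let ?F = "\<lambda>u x. (iexp (u * x) - 1 - \<i> * of_real (u * x)) * complex_of_real (\<nu> x)"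
  have "((\<lambda>u. LINT x|lborel. ?F u x) has_vector_derivative jump_drift \<nu> u) (at u)"
    unfolding jump_drift_def
  proof (rule has_vector_derivative_integral_dominated[where w = "\<lambda>x. (\<bar>u\<bar> + 1) * \<bar>x\<^sup>2 * \<nu> x\<bar>"])
    show "integrable lborel (?F v)" for v
    proof (rule Bochner_Integration.integrable_bound)
      show "integrable lborel (\<lambda>x. v\<^sup>2 * (x\<^sup>2 * \<nu> x))"
        using second_moment by simp
      show "AE x in lborel. norm (?F v x) \<le> norm (v\<^sup>2 * (x\<^sup>2 * \<nu> x))"
      proof (rule AE_I2)
        fix x
        show "norm (?F v x) \<le> norm (v\<^sup>2 * (x\<^sup>2 * \<nu> x))"
          using mult_right_mono[OF norm_iexp_minus_one_minus_linear[of "v * x"], of "\<bar>\<nu> x\<bar>"]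
          by (simp add: norm_mult abs_mult power_mult_distrib mult.assoc)
      qed
    qed measurable
    show "((\<lambda>v. ?F v x) has_vector_derivative \<i> * of_real x * (iexp (v * x) - 1) * complex_of_real (\<nu> x)) (at v)" for v x
    proof -
      have lin: "((\<lambda>v. \<i> * complex_of_real (v * x)) has_vector_derivative \<i> * of_real x) (at v)"
        by (intro has_vector_derivative_mult_right has_vector_derivative_of_real) (auto intro!: derivative_eq_intros)
      have "((\<lambda>v. ?F v x) has_vector_derivative
         (\<i> * of_real x * iexp (v * x) - 0 - \<i> * of_real x) * complex_of_real (\<nu> x)) (at v)"
        by (rule has_vector_derivative_mult_left[OF has_vector_derivative_diff[OF has_vector_derivative_diff[OF
              has_vector_derivative_iexp_linear has_vector_derivative_const] lin]])
      then show ?thesis by (simp add: algebra_simps)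
    qed
    show "norm (\<i> * of_real x * (iexp (v * x) - 1) * complex_of_real (\<nu> x)) \<le> (\<bar>u\<bar> + 1) * \<bar>x\<^sup>2 * \<nu> x\<bar>"
      if "\<bar>v - u\<bar> \<le> 1" for v x
    proof -
      have "norm (iexp (v * x) - 1) \<le> \<bar>v\<bar> * \<bar>x\<bar>"
        using norm_iexp_minus_one[of "v * x"] by (simp add: abs_mult)
      also have "\<dots> \<le> (\<bar>u\<bar> + 1) * \<bar>x\<bar>"
        using that by (intro mult_right_mono) auto
      finally have "\<bar>x\<bar> * norm (iexp (v * x) - 1) * \<bar>\<nu> x\<bar> \<le> \<bar>x\<bar> * ((\<bar>u\<bar> + 1) * \<bar>x\<bar>) * \<bar>\<nu> x\<bar>"
        by (intro mult_right_mono mult_left_mono) auto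
      then show ?thesis
        by (simp add: norm_mult abs_mult power2_eq_square mult_ac)
    qed
    show "integrable lborel (\<lambda>x. (\<bar>u\<bar> + 1) * \<bar>x\<^sup>2 * \<nu> x\<bar>)"
      using second_moment by (intro integrable_mult_right integrable_abs)
  qed measurable
  moreover have "((\<lambda>u. \<i> * complex_of_real (u * b)) has_vector_derivative \<i> * of_real b) (at u)"
    by (intro has_vector_derivative_mult_right has_vector_derivative_of_real) (auto intro!: derivative_eq_intros)
  ultimately have "((\<lambda>u. \<i> * complex_of_real (u * b) + (LINT x|lborel. ?F u x)) has_vector_derivative
      \<i> * of_real b + jump_drift \<nu> u) (at u)"
    by (intro has_vector_derivative_add)
  then show ?thesis
    unfolding levy_exponent_def[abs_def] by simp
qed

lemma jump_drift_derivative: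
  "(jump_drift \<nu> has_vector_derivative - fourier (levy_h \<nu>) u) (at u)"
proof -
  let ?F = "\<lambda>u x. \<i> * of_real x * (iexp (u * x) - 1) * complex_of_real (\<nu> x)"
  have "((\<lambda>u. LINT x|lborel. ?F u x) has_vector_derivative
      (LINT x|lborel. - (iexp (u * x) * of_real (levy_h \<nu> x)))) (at u)"
  proof (rule has_vector_derivative_integral_dominated[where w = "\<lambda>x. \<bar>x\<^sup>2 * \<nu> x\<bar>"])
    show "integrable lborel (?F v)" for v
    proof (rule Bochner_Integration.integrable_bound)
      show "integrable lborel (\<lambda>x. v * (x\<^sup>2 * \<nu> x))"
        using second_moment by simp
      show "AE x in lborel. norm (?F v x) \<le> norm (v * (x\<^sup>2 * \<nu> x))"
      proof (rule AE_I2)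
        fix x
        have "\<bar>x\<bar> * norm (iexp (v * x) - 1) * \<bar>\<nu> x\<bar> \<le> \<bar>x\<bar> * \<bar>v * x\<bar> * \<bar>\<nu> x\<bar>"
          by (intro mult_right_mono mult_left_mono norm_iexp_minus_one) auto
        then show "norm (?F v x) \<le> norm (v * (x\<^sup>2 * \<nu> x))"
          by (simp add: norm_mult abs_mult power2_eq_square mult_ac del: abs_mult_self_eq)
      qed
    qed measurable
    show "((\<lambda>v. ?F v x) has_vector_derivative - (iexp (v * x) * of_real (levy_h \<nu> x))) (at v)" for v x
    proof -
      have "((\<lambda>v. ?F v x) has_vector_derivative
         \<i> * of_real x * (\<i> * of_real x * iexp (v * x) - 0) * complex_of_real (\<nu> x)) (at v)"
        by (rule has_vector_derivative_mult_left[OF has_vector_derivative_mult_right[OF has_vector_derivative_diff[OF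
              has_vector_derivative_iexp_linear has_vector_derivative_const]]])
      moreover have "\<i> * of_real x * (\<i> * of_real x * iexp (v * x) - 0) * complex_of_real (\<nu> x) =
         (\<i> * \<i>) * (iexp (v * x) * of_real (levy_h \<nu> x))"
        unfolding levy_h_def power2_eq_square of_real_mult by (simp only: diff_zero mult_ac)
      ultimately show ?thesis by simp
    qed
    show "(\<lambda>x. - (iexp (u * x) * complex_of_real (levy_h \<nu> x))) \<in> borel_measurable lborel"
      unfolding levy_h_def by measurable
    show "integrable lborel (\<lambda>x. \<bar>x\<^sup>2 * \<nu> x\<bar>)"
      using second_moment by (rule integrable_abs)
  qed (simp add: norm_mult norm_power abs_mult levy_h_def)
  then show ?thesis
    unfolding jump_drift_def[abs_def] fourier_def by simp
qed

text \<open>The oriented integral in \<open>phi_fun\<close> is evaluated by the fundamental theorem of calculus, since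
  \<open>jump_drift \<nu>\<close> is a primitive of \<open>- h\<^sup>*\<close> that vanishes at \<open>0\<close>.\<close>
lemma phi_fun_eq: "phi_fun b (levy_h \<nu>) u = \<i> * of_real b + jump_drift \<nu> u"
proof -
  have "(LBINT v=ereal 0..ereal u. fourier (levy_h \<nu>) v) = (- jump_drift \<nu> u) - (- jump_drift \<nu> 0)"
  proof (rule interval_integral_FTC_finite)
    show "continuous_on {min 0 u..max 0 u} (fourier (levy_h \<nu>))"
      by (rule continuous_on_fourier[OF integrable_levy_h])
    show "((\<lambda>u. - jump_drift \<nu> u) has_vector_derivative fourier (levy_h \<nu>) v) (at v within {min 0 u..max 0 u})" for v
      using has_vector_derivative_at_within[OF has_vector_derivative_minus[OF jump_drift_derivative]] by simp
  qed
  moreover have "jump_drift \<nu> 0 = 0" by (simp add: jump_drift_def)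
  ultimately show ?thesis by (simp add: phi_fun_def zero_ereal_def)
qed

lemma levy_exponent_derivative:
  "(levy_exponent b 0 \<nu> has_vector_derivative phi_fun b (levy_h \<nu>) u) (at u)"
  unfolding phi_fun_eq by (rule levy_exponent_has_jump_drift)

lemma phi_fun_derivative:
  "(phi_fun b (levy_h \<nu>) has_vector_derivative - fourier (levy_h \<nu>) u) (at u)"
  unfolding phi_fun_eq[abs_def]
  using has_vector_derivative_add[OF has_vector_derivative_const jump_drift_derivative] by simp

end

text \<open>The characteristic function of an increment over a time step \<open>\<Delta>\<close>, for an arbitrary Levy density.\<close>
definition levy_char :: "real \<Rightarrow> real \<Rightarrow> (real \<Rightarrow> real) \<Rightarrow> real \<Rightarrow> complex" where
  "levy_char \<Delta> b \<nu> u = exp (of_real \<Delta> * levy_exponent b 0 \<nu> u)"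

context pure_jump_levy
begin

abbreviation "drift \<equiv> levy_mean M L"
abbreviation "h \<equiv> levy_h \<nu>"
abbreviation "\<phi> \<equiv> phi_fun drift h"
abbreviation "\<psi> \<Delta> \<equiv> levy_char \<Delta> drift \<nu>"

lemma integrable_h: "integrable lborel h"
  by (rule integrable_levy_h[OF density_measurable density_second_moment])

lemma h_measurable[measurable]: "h \<in> borel_measurable borel"
  using borel_measurable_integrable[OF integrable_h] by simp

lemmas \<phi>_derivative = phi_fun_derivative[OF density_measurable density_second_moment]

lemma \<psi>_derivative: "(\<psi> \<Delta> has_vector_derivative of_real \<Delta> * \<phi> u * \<psi> \<Delta> u) (at u)"
proof -
  have "((\<lambda>u. of_real \<Delta> * levy_exponent drift 0 \<nu> u) has_vector_derivative of_real \<Delta> * \<phi> u) (at u)"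
    by (rule has_vector_derivative_mult_right[OF levy_exponent_derivative[OF density_measurable density_second_moment]])
  from field_vector_diff_chain_at[OF this DERIV_exp] show ?thesis
    by (simp add: o_def levy_char_def[abs_def])
qed

text \<open>Since \<open>x\<^sup>2 h x = x\<^sup>4 \<nu> x\<close>, the fourth moment of the Levy density makes \<open>h\<^sup>*\<close> twice continuously differentiable.\<close>
lemma h_star_derivatives:
  fixes u :: real
  defines "h1 \<equiv> \<lambda>u. LINT x|lborel. iexp (u * x) * (\<i> * of_real x * of_real (h x))"
    and "h2 \<equiv> \<lambda>u. LINT x|lborel. iexp (u * x) * (\<i> * of_real x * (\<i> * of_real x * of_real (h x)))"
  shows "(fourier h has_vector_derivative h1 u) (at u)" "(h1 has_vector_derivative h2 u) (at u)" "isCont h2 u"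
proof -
  have x2h: "integrable lborel (\<lambda>x. x\<^sup>2 * h x)"
    using density_fourth_moment by (simp add: levy_h_def mult.assoc[symmetric] power_add[symmetric])
  have xh: "integrable lborel (\<lambda>x. x * h x)"
  proof (rule Bochner_Integration.integrable_bound)
    show "integrable lborel (\<lambda>x. x\<^sup>2 * h x + h x)" using x2h integrable_h by simp
    show "AE x in lborel. norm (x * h x) \<le> norm (x\<^sup>2 * h x + h x)"
    proof (rule AE_I2)
      fix x :: real
      have "2 * \<bar>x\<bar> * 1 \<le> x\<^sup>2 + 1" using sum_squares_bound[of "\<bar>x\<bar>" 1] by simp
      then have "\<bar>x\<bar> * \<bar>h x\<bar> \<le> (x\<^sup>2 + 1) * \<bar>h x\<bar>" by (intro mult_right_mono) auto
      also have "(x\<^sup>2 + 1) * \<bar>h x\<bar> = \<bar>(x\<^sup>2 + 1) * h x\<bar>" by (simp add: abs_mult)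
      finally show "norm (x * h x) \<le> norm (x\<^sup>2 * h x + h x)" by (simp add: abs_mult distrib_right)
    qed
  qed measurable
  have c0: "integrable lborel (\<lambda>x. complex_of_real (h x))" using integrable_h by simp
  have c1: "integrable lborel (\<lambda>x. complex_of_real x * complex_of_real (h x))"
    using xh by (simp add: of_real_mult[symmetric] del: of_real_mult)
  have c2: "integrable lborel (\<lambda>x. complex_of_real x * (complex_of_real x * complex_of_real (h x)))"
    using x2h by (simp add: of_real_mult[symmetric] power2_eq_square mult.assoc del: of_real_mult)
  have c1': "integrable lborel (\<lambda>x. \<i> * complex_of_real x * complex_of_real (h x))"
    using integrable_mult_right[OF c1, of \<i>] by (simp add: mult.assoc)
  have c2': "integrable lborel (\<lambda>x. complex_of_real x * (\<i> * complex_of_real x * complex_of_real (h x)))"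
    using integrable_mult_right[OF c2, of \<i>] by (simp add: mult_ac)
  have c2'': "integrable lborel (\<lambda>x. \<i> * complex_of_real x * (\<i> * complex_of_real x * complex_of_real (h x)))"
    using integrable_mult_right[OF c2', of \<i>] by (simp add: mult.assoc)
  show "(fourier h has_vector_derivative h1 u) (at u)"
    unfolding fourier_def[abs_def] h1_def
    by (rule has_vector_derivative_integral_iexp[OF _ c0 c1]) simp
  show "(h1 has_vector_derivative h2 u) (at u)"
    unfolding h1_def h2_def
    by (rule has_vector_derivative_integral_iexp[OF _ c1' c2']) simp
  show "isCont h2 u"
    unfolding h2_def by (rule isCont_integral_iexp[OF _ c2'']) simp
qed

lemma isCont_\<phi>: "isCont \<phi> u"
  using \<phi>_derivative by (rule has_vector_derivative_continuous)

lemma isCont_\<psi>: "isCont (\<psi> \<Delta>) u"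
  using \<psi>_derivative by (rule has_vector_derivative_continuous)

lemma isCont_h_star: "isCont (fourier h) u"
  by (rule isCont_fourier[OF integrable_h])

lemma \<psi>_second_derivative:
  "((\<lambda>u. of_real \<Delta> * \<phi> u * \<psi> \<Delta> u) has_vector_derivative
     (- of_real \<Delta> * fourier h u + (of_real \<Delta> * \<phi> u)\<^sup>2) * \<psi> \<Delta> u) (at u)"
proof -
  have "((\<lambda>u. of_real \<Delta> * \<phi> u * \<psi> \<Delta> u) has_vector_derivative
     (of_real \<Delta> * \<phi> u) * (of_real \<Delta> * \<phi> u * \<psi> \<Delta> u) + (of_real \<Delta> * (- fourier h u)) * \<psi> \<Delta> u) (at u)"
    by (rule has_vector_derivative_mult[OF has_vector_derivative_mult_right[OF \<phi>_derivative] \<psi>_derivative])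
  then show ?thesis by (simp add: power2_eq_square algebra_simps)
qed

context
  fixes \<Delta> :: real
  assumes \<Delta>: "\<Delta> \<ge> 0"
begin

lemma L_measurable[measurable]: "L \<Delta> \<in> borel_measurable M"
  by (rule random_variable_L[OF \<Delta>])

lemma char_L: "expectation (\<lambda>\<omega>. iexp (u * L \<Delta> \<omega>)) = \<psi> \<Delta> u"
proof -
  have "\<psi> \<Delta> u = char (distr M borel (L \<Delta>)) u"
    using characteristic_function[OF \<Delta>, of u] by (simp add: levy_char_def)
  also have "\<dots> = expectation (\<lambda>\<omega>. iexp (u * L \<Delta> \<omega>))"
    unfolding char_def by (rule integral_distr) auto
  finally show ?thesis by simp
qed

lemma integrable_L_square: "integrable M (\<lambda>\<omega>. (L \<Delta> \<omega>)\<^sup>2)"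
proof -
  have "integrable M (\<lambda>\<omega>. (L \<Delta> \<omega>)\<^sup>2 * 1)"
  proof (rule integrable_square_if_char_C2)
    show "((\<lambda>u. LINT x|M. iexp (u * L \<Delta> x) * complex_of_real 1) has_vector_derivative of_real \<Delta> * \<phi> u * \<psi> \<Delta> u) (at u)" for u
      using \<psi>_derivative[of \<Delta> u] by (simp add: char_L[symmetric, abs_def])
    show "((\<lambda>u. of_real \<Delta> * \<phi> u * \<psi> \<Delta> u) has_vector_derivative
       (- of_real \<Delta> * fourier h u + (of_real \<Delta> * \<phi> u)\<^sup>2) * \<psi> \<Delta> u) (at u)" for u
      by (rule \<psi>_second_derivative)
    show "isCont (\<lambda>u. (- of_real \<Delta> * fourier h u + (of_real \<Delta> * \<phi> u)\<^sup>2) * \<psi> \<Delta> u) u" for u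
      by (intro continuous_intros isCont_\<phi> isCont_\<psi> isCont_h_star)
  qed simp_all
  then show ?thesis by simp
qed

lemma integrable_L: "integrable M (L \<Delta>)"
  by (rule square_integrable_imp_integrable[OF _ integrable_L_square]) simp

lemma expectation_first_derivative:
  "expectation (\<lambda>\<omega>. iexp (u * L \<Delta> \<omega>) * (\<i> * of_real (L \<Delta> \<omega>))) = of_real \<Delta> * \<phi> u * \<psi> \<Delta> u"
proof (rule vector_derivative_unique_at)
  show "(\<psi> \<Delta> has_vector_derivative of_real \<Delta> * \<phi> u * \<psi> \<Delta> u) (at u)"
    by (rule \<psi>_derivative)
  show "(\<psi> \<Delta> has_vector_derivative expectation (\<lambda>\<omega>. iexp (u * L \<Delta> \<omega>) * (\<i> * of_real (L \<Delta> \<omega>)))) (at u)"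
    using has_vector_derivative_integral_iexp[of "L \<Delta>" M "\<lambda>_. 1" u] integrable_L
    by (simp add: char_L[symmetric, abs_def])
qed

lemma expectation_second_derivative:
  "expectation (\<lambda>\<omega>. iexp (u * L \<Delta> \<omega>) * (\<i> * of_real (L \<Delta> \<omega>))\<^sup>2) =
     (- of_real \<Delta> * fourier h u + (of_real \<Delta> * \<phi> u)\<^sup>2) * \<psi> \<Delta> u"
proof (rule vector_derivative_unique_at)
  show "((\<lambda>u. of_real \<Delta> * \<phi> u * \<psi> \<Delta> u) has_vector_derivative
     (- of_real \<Delta> * fourier h u + (of_real \<Delta> * \<phi> u)\<^sup>2) * \<psi> \<Delta> u) (at u)"
    by (rule \<psi>_second_derivative)
  have 1: "integrable M (\<lambda>\<omega>. \<i> * complex_of_real (L \<Delta> \<omega>))"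
    using integrable_L by simp
  have 2: "integrable M (\<lambda>\<omega>. complex_of_real (L \<Delta> \<omega>) * (\<i> * complex_of_real (L \<Delta> \<omega>)))"
  proof -
    have "integrable M (\<lambda>\<omega>. \<i> * complex_of_real ((L \<Delta> \<omega>)\<^sup>2))"
      using integrable_L_square by (intro integrable_mult_right integrable_of_real)
    then show ?thesis by (simp add: power2_eq_square mult_ac)
  qed
  have "((\<lambda>u. expectation (\<lambda>\<omega>. iexp (u * L \<Delta> \<omega>) * (\<i> * of_real (L \<Delta> \<omega>)))) has_vector_derivative
     expectation (\<lambda>\<omega>. iexp (u * L \<Delta> \<omega>) * (\<i> * of_real (L \<Delta> \<omega>) * (\<i> * of_real (L \<Delta> \<omega>))))) (at u)"
    by (rule has_vector_derivative_integral_iexp[OF _ 1 2]) simp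
  then show "((\<lambda>u. of_real \<Delta> * \<phi> u * \<psi> \<Delta> u) has_vector_derivative
     expectation (\<lambda>\<omega>. iexp (u * L \<Delta> \<omega>) * (\<i> * of_real (L \<Delta> \<omega>))\<^sup>2)) (at u)"
    by (simp only: expectation_first_derivative power2_eq_square)
qed

text \<open>The weight is now \<open>(L \<Delta>)\<^sup>2\<close>. Its transform is \<open>- \<psi>'' = (\<Delta> h\<^sup>* - \<Delta>\<^sup>2 \<phi>\<^sup>2) \<psi>\<close>, which is twice continuously
  differentiable because \<open>h\<^sup>*\<close>, \<open>\<phi>\<close> and \<open>\<psi>\<close> are.\<close>
lemma integrable_L_fourth: "integrable M (\<lambda>\<omega>. (L \<Delta> \<omega>) ^ 4)"
proof -
  let ?h1 = "\<lambda>u. LINT x|lborel. iexp (u * x) * (\<i> * of_real x * of_real (h x))"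
  let ?h2 = "\<lambda>u. LINT x|lborel. iexp (u * x) * (\<i> * of_real x * (\<i> * of_real x * of_real (h x)))"
  \<comment> \<open>The transform of the weighted law is \<open>?p * \<psi>\<close>; \<open>?p1\<close> and \<open>?p2\<close> are the derivatives of \<open>?p\<close>.\<close>
  let ?p = "\<lambda>u. of_real \<Delta> * fourier h u - (of_real \<Delta> * \<phi> u) * (of_real \<Delta> * \<phi> u)"
  let ?p1 = "\<lambda>u. of_real \<Delta> * ?h1 u - ((of_real \<Delta> * \<phi> u) * (of_real \<Delta> * (- fourier h u)) + (of_real \<Delta> * (- fourier h u)) * (of_real \<Delta> * \<phi> u))"
  let ?p2 = "\<lambda>u. of_real \<Delta> * ?h2 u -
      (((of_real \<Delta> * \<phi> u) * (of_real \<Delta> * (- ?h1 u)) + (of_real \<Delta> * (- fourier h u)) * (of_real \<Delta> * (- fourier h u))) +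
      ((of_real \<Delta> * (- fourier h u)) * (of_real \<Delta> * (- fourier h u)) + (of_real \<Delta> * (- ?h1 u)) * (of_real \<Delta> * \<phi> u)))"
  let ?d1 = "\<lambda>u. of_real \<Delta> * \<phi> u * \<psi> \<Delta> u"
  let ?d2 = "\<lambda>u. (- of_real \<Delta> * fourier h u + (of_real \<Delta> * \<phi> u)\<^sup>2) * \<psi> \<Delta> u"
  have p: "(?p has_vector_derivative ?p1 u) (at u)" for u
    by (rule has_vector_derivative_diff[OF has_vector_derivative_mult_right[OF h_star_derivatives(1)]
        has_vector_derivative_mult[OF has_vector_derivative_mult_right[OF \<phi>_derivative] has_vector_derivative_mult_right[OF \<phi>_derivative]]])
  note D\<phi> = has_vector_derivative_mult_right[OF \<phi>_derivative, of "of_real \<Delta>"]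
  note Dh = has_vector_derivative_mult_right[OF has_vector_derivative_minus[OF h_star_derivatives(1)], of "of_real \<Delta>"]
  have p1: "(?p1 has_vector_derivative ?p2 u) (at u)" for u
    by (rule has_vector_derivative_diff[OF has_vector_derivative_mult_right[OF h_star_derivatives(2)]
        has_vector_derivative_add[OF has_vector_derivative_mult[OF D\<phi> Dh] has_vector_derivative_mult[OF Dh D\<phi>]]])
  have h1c: "isCont ?h1 u" for u
    using h_star_derivatives(2) by (rule has_vector_derivative_continuous)
  have F: "(LINT x|M. iexp (u * L \<Delta> x) * complex_of_real ((L \<Delta> x)\<^sup>2)) = ?p u * \<psi> \<Delta> u" for u
  proof -
    have "(LINT x|M. iexp (u * L \<Delta> x) * complex_of_real ((L \<Delta> x)\<^sup>2)) =
       (LINT x|M. - (iexp (u * L \<Delta> x) * (\<i> * of_real (L \<Delta> x))\<^sup>2))"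
      by (intro Bochner_Integration.integral_cong refl) (simp add: power_mult_distrib)
    also have "\<dots> = - expectation (\<lambda>\<omega>. iexp (u * L \<Delta> \<omega>) * (\<i> * of_real (L \<Delta> \<omega>))\<^sup>2)"
      by simp
    also have "\<dots> = ?p u * \<psi> \<Delta> u"
      unfolding expectation_second_derivative by (simp add: power2_eq_square algebra_simps)
    finally show ?thesis .
  qed
  have "integrable M (\<lambda>\<omega>. (L \<Delta> \<omega>)\<^sup>2 * (L \<Delta> \<omega>)\<^sup>2)"
  proof (rule integrable_square_if_char_C2)
    show "((\<lambda>u. LINT x|M. iexp (u * L \<Delta> x) * complex_of_real ((L \<Delta> x)\<^sup>2)) has_vector_derivative
        ?p u * ?d1 u + ?p1 u * \<psi> \<Delta> u) (at u)" for u
      unfolding F by (rule has_vector_derivative_mult[OF p \<psi>_derivative])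
    show "((\<lambda>u. ?p u * ?d1 u + ?p1 u * \<psi> \<Delta> u) has_vector_derivative
        (?p u * ?d2 u + ?p1 u * ?d1 u) + (?p1 u * ?d1 u + ?p2 u * \<psi> \<Delta> u)) (at u)" for u
      by (rule has_vector_derivative_add[OF has_vector_derivative_mult[OF p \<psi>_second_derivative]
            has_vector_derivative_mult[OF p1 \<psi>_derivative]])
    show "isCont (\<lambda>u. (?p u * ?d2 u + ?p1 u * ?d1 u) + (?p1 u * ?d1 u + ?p2 u * \<psi> \<Delta> u)) u" for u
      by (intro continuous_intros isCont_\<phi> isCont_\<psi> isCont_h_star h1c h_star_derivatives(3))
  qed (use integrable_L_square in auto)
  then show ?thesis by (simp add: power_add[symmetric])
qed

end

end

section \<open>Sample means of independent complex variables\<close>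

context prob_space
begin

lemma integrable_of_square:
  fixes Y :: "'a \<Rightarrow> complex"
  assumes [measurable]: "Y \<in> borel_measurable M" and sq: "integrable M (\<lambda>\<omega>. (norm (Y \<omega>))\<^sup>2)"
  shows "integrable M Y"
proof -
  have "integrable M (\<lambda>\<omega>. norm (Y \<omega>))"
    by (rule square_integrable_imp_integrable[OF _ sq]) simp
  then show ?thesis by (simp add: integrable_norm_iff)
qed

lemma complex_variance:
  fixes Y :: "'a \<Rightarrow> complex"
  assumes [measurable]: "Y \<in> borel_measurable M" and sq: "integrable M (\<lambda>\<omega>. (norm (Y \<omega>))\<^sup>2)"
  shows "integrable M (\<lambda>\<omega>. (norm (Y \<omega> - expectation Y))\<^sup>2)"
    and "expectation (\<lambda>\<omega>. (norm (Y \<omega> - expectation Y))\<^sup>2) = expectation (\<lambda>\<omega>. (norm (Y \<omega>))\<^sup>2) - (norm (expectation Y))\<^sup>2"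
proof -
  have Y: "integrable M Y" by (rule integrable_of_square[OF _ sq]) simp
  define a where "a = expectation Y"
  have eq: "(norm (Y \<omega> - a))\<^sup>2 = (norm (Y \<omega>))\<^sup>2 - 2 * (Y \<omega> \<bullet> a) + (norm a)\<^sup>2" for \<omega>
    by (simp add: power2_norm_eq_inner inner_diff_left inner_diff_right inner_commute)
  have i: "integrable M (\<lambda>\<omega>. Y \<omega> \<bullet> a)" using Y by simp
  show "integrable M (\<lambda>\<omega>. (norm (Y \<omega> - expectation Y))\<^sup>2)"
    unfolding a_def[symmetric] eq using sq i by simp
  have "expectation (\<lambda>\<omega>. (norm (Y \<omega> - a))\<^sup>2) = expectation (\<lambda>\<omega>. (norm (Y \<omega>))\<^sup>2) - 2 * (expectation Y \<bullet> a) + (norm a)\<^sup>2"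
    unfolding eq using sq i Y by (simp add: prob_space)
  then show "expectation (\<lambda>\<omega>. (norm (Y \<omega> - expectation Y))\<^sup>2) = expectation (\<lambda>\<omega>. (norm (Y \<omega>))\<^sup>2) - (norm (expectation Y))\<^sup>2"
    by (simp add: a_def power2_norm_eq_inner)
qed

lemma norm_expectation_square_le:
  fixes Y :: "'a \<Rightarrow> complex"
  assumes "Y \<in> borel_measurable M" and "integrable M (\<lambda>\<omega>. (norm (Y \<omega>))\<^sup>2)"
  shows "(norm (expectation Y))\<^sup>2 \<le> expectation (\<lambda>\<omega>. (norm (Y \<omega>))\<^sup>2)"
proof -
  have "0 \<le> expectation (\<lambda>\<omega>. (norm (Y \<omega> - expectation Y))\<^sup>2)" by simp
  with complex_variance(2)[OF assms] show ?thesis by simp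
qed

lemma integrable_norm_sum_square:
  fixes Y :: "'i \<Rightarrow> 'a \<Rightarrow> complex"
  assumes I: "finite I" and [measurable]: "\<And>i. i \<in> I \<Longrightarrow> Y i \<in> borel_measurable M"
    and sq: "\<And>i. i \<in> I \<Longrightarrow> integrable M (\<lambda>\<omega>. (norm (Y i \<omega>))\<^sup>2)"
  shows "integrable M (\<lambda>\<omega>. (norm (\<Sum>i\<in>I. Y i \<omega>))\<^sup>2)"
    and "expectation (\<lambda>\<omega>. (norm (\<Sum>i\<in>I. Y i \<omega>))\<^sup>2) = (\<Sum>i\<in>I. \<Sum>j\<in>I. expectation (\<lambda>\<omega>. Y i \<omega> \<bullet> Y j \<omega>))"
proof -
  have ij: "integrable M (\<lambda>\<omega>. Y i \<omega> \<bullet> Y j \<omega>)" if "i \<in> I" "j \<in> I" for i j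
    by (rule integrable_inner_of_squares) (use that sq in auto)
  have eq: "(norm (\<Sum>i\<in>I. Y i \<omega>))\<^sup>2 = (\<Sum>i\<in>I. \<Sum>j\<in>I. Y i \<omega> \<bullet> Y j \<omega>)" for \<omega>
    by (simp only: power2_norm_eq_inner inner_sum_left) (simp only: inner_sum_right)
  show "integrable M (\<lambda>\<omega>. (norm (\<Sum>i\<in>I. Y i \<omega>))\<^sup>2)"
    unfolding eq by (intro Bochner_Integration.integrable_sum ij)
  show "expectation (\<lambda>\<omega>. (norm (\<Sum>i\<in>I. Y i \<omega>))\<^sup>2) = (\<Sum>i\<in>I. \<Sum>j\<in>I. expectation (\<lambda>\<omega>. Y i \<omega> \<bullet> Y j \<omega>))"
    unfolding eq by (simp add: Bochner_Integration.integral_sum Bochner_Integration.integrable_sum ij)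
qed

lemma expectation_inner_centered_indep:
  fixes Y :: "'i \<Rightarrow> 'a \<Rightarrow> complex"
  assumes ind: "indep_vars (\<lambda>_. borel) Y I" and ij: "i \<in> I" "j \<in> I" "i \<noteq> j"
    and int: "integrable M (Y i)" "integrable M (Y j)"
  shows "expectation (\<lambda>\<omega>. (Y i \<omega> - expectation (Y i)) \<bullet> (Y j \<omega> - expectation (Y j))) = 0"
proof -
  let ?c = "\<lambda>k z. z - expectation (Y k)"
  have [measurable]: "cnj \<in> borel_measurable borel"
    by (intro borel_measurable_continuous_onI continuous_intros)
  have iv: "indep_var (PiM {i} (\<lambda>_. borel)) (\<lambda>\<omega>. restrict (\<lambda>k. Y k \<omega>) {i}) (PiM {j} (\<lambda>_. borel)) (\<lambda>\<omega>. restrict (\<lambda>k. Y k \<omega>) {j})"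
    by (rule indep_var_restrict[OF ind]) (use ij in auto)
  have "indep_var borel ((\<lambda>f. ?c i (f i)) \<circ> (\<lambda>\<omega>. restrict (\<lambda>k. Y k \<omega>) {i}))
      borel ((\<lambda>f. cnj (?c j (f j))) \<circ> (\<lambda>\<omega>. restrict (\<lambda>k. Y k \<omega>) {j}))"
    by (rule indep_var_compose[OF iv]) measurable
  then have iv': "indep_var borel (\<lambda>\<omega>. ?c i (Y i \<omega>)) borel (\<lambda>\<omega>. cnj (?c j (Y j \<omega>)))"
    by (simp add: o_def)
  have i1: "integrable M (\<lambda>\<omega>. ?c i (Y i \<omega>))" and i2: "integrable M (\<lambda>\<omega>. cnj (?c j (Y j \<omega>)))"
    using int by simp_all
  have z: "expectation (\<lambda>\<omega>. ?c i (Y i \<omega>)) = 0"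
    using int by (simp add: prob_space)
  have p0: "expectation (\<lambda>\<omega>. ?c i (Y i \<omega>) * cnj (?c j (Y j \<omega>))) = 0"
    using indep_var_lebesgue_integral[OF iv' i1 i2] z by simp
  have "expectation (\<lambda>\<omega>. ?c i (Y i \<omega>) \<bullet> ?c j (Y j \<omega>)) = expectation (\<lambda>\<omega>. Re (?c i (Y i \<omega>) * cnj (?c j (Y j \<omega>))))"
    by (intro Bochner_Integration.integral_cong refl) (simp add: inner_complex_def right_diff_distrib)
  also have "\<dots> = Re (expectation (\<lambda>\<omega>. ?c i (Y i \<omega>) * cnj (?c j (Y j \<omega>))))"
    by (rule integral_Re[OF indep_var_integrable[OF iv' i1 i2]])
  finally show ?thesis using p0 by simp
qed

text \<open>Centred independent variables are orthogonal, so the squared norm of their sum has the expectation of its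
  diagonal part.\<close>
lemma mean_square_error_of_sample_mean:
  fixes Y :: "'i \<Rightarrow> 'a \<Rightarrow> complex"
  assumes I: "finite I" "I \<noteq> {}" and ind: "indep_vars (\<lambda>_. borel) Y I"
    and sq: "\<And>i. i \<in> I \<Longrightarrow> integrable M (\<lambda>\<omega>. (norm (Y i \<omega>))\<^sup>2)"
    and mean: "\<And>i. i \<in> I \<Longrightarrow> expectation (Y i) = a"
    and V: "\<And>i. i \<in> I \<Longrightarrow> expectation (\<lambda>\<omega>. (norm (Y i \<omega>))\<^sup>2) \<le> V"
  defines "S \<equiv> \<lambda>\<omega>. of_real (1 / real (card I)) * (\<Sum>i\<in>I. Y i \<omega>)"
  shows "integrable M (\<lambda>\<omega>. (norm (S \<omega> - a))\<^sup>2)"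
    and "expectation (\<lambda>\<omega>. (norm (S \<omega> - a))\<^sup>2) \<le> V / real (card I)"
proof -
  have meas[measurable]: "Y i \<in> borel_measurable M" if "i \<in> I" for i
    using ind that by (auto simp: indep_vars_def)
  have N: "real (card I) > 0" using I by (simp add: card_gt_0_iff)
  have int: "integrable M (Y i)" if "i \<in> I" for i
    by (rule integrable_of_square[OF meas sq]) (use that in auto)
  have csq: "integrable M (\<lambda>\<omega>. (norm (Y i \<omega> - a))\<^sup>2)" "expectation (\<lambda>\<omega>. (norm (Y i \<omega> - a))\<^sup>2) \<le> V"
    if "i \<in> I" for i
    using complex_variance[OF meas sq, of i] that V[OF that] mean[OF that]
      order_trans[OF _ V[OF that], of "expectation (\<lambda>\<omega>. (norm (Y i \<omega>))\<^sup>2) - (norm (expectation (Y i)))\<^sup>2"] by auto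
  have S: "(norm (S \<omega> - a))\<^sup>2 = 1 / (real (card I))\<^sup>2 * (norm (\<Sum>i\<in>I. Y i \<omega> - a))\<^sup>2" for \<omega>
  proof -
    have "S \<omega> - a = of_real (1 / real (card I)) * (\<Sum>i\<in>I. Y i \<omega> - a)"
      using N by (simp add: S_def sum_subtractf field_simps)
    then show ?thesis by (simp add: norm_mult norm_divide power_mult_distrib power_divide)
  qed
  have sum_int: "integrable M (\<lambda>\<omega>. (norm (\<Sum>i\<in>I. Y i \<omega> - a))\<^sup>2)"
    by (rule integrable_norm_sum_square(1)) (use I csq in auto)
  then show "integrable M (\<lambda>\<omega>. (norm (S \<omega> - a))\<^sup>2)"
    unfolding S by (rule integrable_mult_right)
  have "expectation (\<lambda>\<omega>. (norm (\<Sum>i\<in>I. Y i \<omega> - a))\<^sup>2) = (\<Sum>i\<in>I. \<Sum>j\<in>I. expectation (\<lambda>\<omega>. (Y i \<omega> - a) \<bullet> (Y j \<omega> - a)))"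
    by (rule integrable_norm_sum_square(2)) (use I csq in auto)
  also have "\<dots> = (\<Sum>i\<in>I. \<Sum>j\<in>I. if i = j then expectation (\<lambda>\<omega>. (norm (Y i \<omega> - a))\<^sup>2) else 0)"
  proof (intro sum.cong refl)
    fix i j assume ij: "i \<in> I" "j \<in> I"
    show "expectation (\<lambda>\<omega>. (Y i \<omega> - a) \<bullet> (Y j \<omega> - a)) = (if i = j then expectation (\<lambda>\<omega>. (norm (Y i \<omega> - a))\<^sup>2) else 0)"
      using expectation_inner_centered_indep[OF ind ij _ int int] ij mean
      by (auto simp: power2_norm_eq_inner)
  qed
  also have "\<dots> = (\<Sum>i\<in>I. expectation (\<lambda>\<omega>. (norm (Y i \<omega> - a))\<^sup>2))"
    using I by simp
  also have "\<dots> \<le> (\<Sum>i\<in>I. V)"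
    by (intro sum_mono csq)
  finally have "expectation (\<lambda>\<omega>. (norm (\<Sum>i\<in>I. Y i \<omega> - a))\<^sup>2) \<le> real (card I) * V"
    by simp
  then have "1 / (real (card I))\<^sup>2 * expectation (\<lambda>\<omega>. (norm (\<Sum>i\<in>I. Y i \<omega> - a))\<^sup>2) \<le> 1 / (real (card I))\<^sup>2 * (real (card I) * V)"
    by (intro mult_left_mono) auto
  also have "\<dots> = V / real (card I)"
    using N by (simp add: power2_eq_square)
  finally show "expectation (\<lambda>\<omega>. (norm (S \<omega> - a))\<^sup>2) \<le> V / real (card I)"
    unfolding S by simp
qed

lemma mean_square_of_sample_mean:
  fixes Y :: "'i \<Rightarrow> 'a \<Rightarrow> complex"
  assumes I: "finite I" "I \<noteq> {}" and meas[measurable]: "\<And>i. i \<in> I \<Longrightarrow> Y i \<in> borel_measurable M"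
    and sq: "\<And>i. i \<in> I \<Longrightarrow> integrable M (\<lambda>\<omega>. (norm (Y i \<omega>))\<^sup>2)"
    and V: "\<And>i. i \<in> I \<Longrightarrow> expectation (\<lambda>\<omega>. (norm (Y i \<omega>))\<^sup>2) \<le> V"
  defines "S \<equiv> \<lambda>\<omega>. of_real (1 / real (card I)) * (\<Sum>i\<in>I. Y i \<omega>)"
  shows "integrable M (\<lambda>\<omega>. (norm (S \<omega>))\<^sup>2)" and "expectation (\<lambda>\<omega>. (norm (S \<omega>))\<^sup>2) \<le> V"
proof -
  have N: "real (card I) > 0" using I by (simp add: card_gt_0_iff)
  have le: "(norm (S \<omega>))\<^sup>2 \<le> 1 / real (card I) * (\<Sum>i\<in>I. (norm (Y i \<omega>))\<^sup>2)" for \<omega>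
  proof -
    have "(norm (\<Sum>i\<in>I. Y i \<omega>))\<^sup>2 \<le> (\<Sum>i\<in>I. norm (Y i \<omega>))\<^sup>2"
      by (intro power_mono norm_sum) simp
    also have "\<dots> \<le> (\<Sum>i\<in>I. (norm (Y i \<omega>))\<^sup>2) * card I"
      by (rule sum_squared_le_sum_of_squares)
    finally have "1 / (real (card I))\<^sup>2 * (norm (\<Sum>i\<in>I. Y i \<omega>))\<^sup>2 \<le> 1 / (real (card I))\<^sup>2 * ((\<Sum>i\<in>I. (norm (Y i \<omega>))\<^sup>2) * card I)"
      by (intro mult_left_mono) auto
    then show ?thesis
      using N by (simp add: S_def norm_mult norm_divide power_mult_distrib power_divide power2_eq_square[of "real (card I)"])
  qed
  have Sm[measurable]: "S \<in> borel_measurable M"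
    unfolding S_def by measurable
  have ub: "integrable M (\<lambda>\<omega>. 1 / real (card I) * (\<Sum>i\<in>I. (norm (Y i \<omega>))\<^sup>2))"
    by (intro integrable_mult_right Bochner_Integration.integrable_sum sq)
  show int: "integrable M (\<lambda>\<omega>. (norm (S \<omega>))\<^sup>2)"
  proof (rule Bochner_Integration.integrable_bound[OF ub])
    show "AE \<omega> in M. norm ((norm (S \<omega>))\<^sup>2) \<le> norm (1 / real (card I) * (\<Sum>i\<in>I. (norm (Y i \<omega>))\<^sup>2))"
      unfolding real_norm_def abs_power2 by (intro AE_I2 order_trans[OF le abs_ge_self])
  qed measurable
  have "expectation (\<lambda>\<omega>. (norm (S \<omega>))\<^sup>2) \<le> expectation (\<lambda>\<omega>. 1 / real (card I) * (\<Sum>i\<in>I. (norm (Y i \<omega>))\<^sup>2))"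
    by (rule integral_mono[OF int ub le])
  also have "\<dots> = 1 / real (card I) * (\<Sum>i\<in>I. expectation (\<lambda>\<omega>. (norm (Y i \<omega>))\<^sup>2))"
    using sq by (simp add: Bochner_Integration.integral_sum)
  also have "\<dots> \<le> 1 / real (card I) * (\<Sum>i\<in>I. V)"
    by (intro mult_left_mono sum_mono V) auto
  also have "\<dots> = V" using N by simp
  finally show "expectation (\<lambda>\<omega>. (norm (S \<omega>))\<^sup>2) \<le> V" .
qed

text \<open>Functions of disjoint blocks of an independent family are independent, hence uncorrelated.\<close>
lemma expectation_mult_disjoint_blocks:
  fixes F G :: "('i \<Rightarrow> 'b) \<Rightarrow> real"
  assumes ind: "indep_vars N X I" and AB: "A \<inter> B = {}" "A \<subseteq> I" "B \<subseteq> I"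
    and F: "F \<in> borel_measurable (PiM A N)" and G: "G \<in> borel_measurable (PiM B N)"
    and iF: "integrable M (\<lambda>\<omega>. F (restrict (\<lambda>i. X i \<omega>) A))" and iG: "integrable M (\<lambda>\<omega>. G (restrict (\<lambda>i. X i \<omega>) B))"
  shows "integrable M (\<lambda>\<omega>. F (restrict (\<lambda>i. X i \<omega>) A) * G (restrict (\<lambda>i. X i \<omega>) B))"
    and "expectation (\<lambda>\<omega>. F (restrict (\<lambda>i. X i \<omega>) A) * G (restrict (\<lambda>i. X i \<omega>) B)) =
         expectation (\<lambda>\<omega>. F (restrict (\<lambda>i. X i \<omega>) A)) * expectation (\<lambda>\<omega>. G (restrict (\<lambda>i. X i \<omega>) B))"
proof -
  have "indep_var borel (F \<circ> (\<lambda>\<omega>. restrict (\<lambda>i. X i \<omega>) A)) borel (G \<circ> (\<lambda>\<omega>. restrict (\<lambda>i. X i \<omega>) B))"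
    by (rule indep_var_compose[OF indep_var_restrict[OF ind AB] F G])
  then have iv: "indep_var borel (\<lambda>\<omega>. F (restrict (\<lambda>i. X i \<omega>) A)) borel (\<lambda>\<omega>. G (restrict (\<lambda>i. X i \<omega>) B))"
    by (simp add: o_def)
  show "integrable M (\<lambda>\<omega>. F (restrict (\<lambda>i. X i \<omega>) A) * G (restrict (\<lambda>i. X i \<omega>) B))"
    by (rule indep_var_integrable[OF iv iF iG])
  show "expectation (\<lambda>\<omega>. F (restrict (\<lambda>i. X i \<omega>) A) * G (restrict (\<lambda>i. X i \<omega>) B)) =
         expectation (\<lambda>\<omega>. F (restrict (\<lambda>i. X i \<omega>) A)) * expectation (\<lambda>\<omega>. G (restrict (\<lambda>i. X i \<omega>) B))"
    by (rule indep_var_lebesgue_integral[OF iv iF iG])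
qed

end

section \<open>Empirical derivatives of the characteristic function\<close>

text \<open>The \<open>j\<close>-th derivative in \<open>u\<close> of the character \<open>exp (\<i> u z)\<close>.\<close>
definition score :: "real \<Rightarrow> nat \<Rightarrow> real \<Rightarrow> complex" where
  "score u j z = (\<i> * of_real z) ^ j * iexp (u * z)"

lemma norm_score_square: "(norm (score u j z))\<^sup>2 = z ^ (2 * j)"
  by (simp add: score_def norm_mult norm_power power_mult[symmetric] mult.commute[of j])
     (simp add: power_mult)

lemma score_measurable[measurable]: "score u j \<in> borel_measurable borel"
  unfolding score_def[abs_def] by measurable

text \<open>A common form of all empirical derivatives, with an arbitrary set \<open>A\<close> of sample indices. Indices are counted from 0,
  so index \<open>i\<close> refers to the increment over \<open>[i \<Delta>, (i + 1) \<Delta>]\<close>, which is \<open>Z L \<Delta> (Suc i)\<close>.\<close>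
definition sample_score :: "(real \<Rightarrow> 'a \<Rightarrow> real) \<Rightarrow> real \<Rightarrow> nat set \<Rightarrow> real \<Rightarrow> nat \<Rightarrow> 'a \<Rightarrow> complex" where
  "sample_score L \<Delta> A u j \<omega> = of_real (1 / real (card A)) * (\<Sum>i\<in>A. score u j (Z L \<Delta> (Suc i) \<omega>))"

lemma psi_hat_eq_sample_score:
  assumes "q \<ge> 1"
  shows "psi_hat L \<Delta> n j q \<omega> u = sample_score L \<Delta> {(q - 1) * n..<q * n} u j \<omega>"
proof -
  have "card {(q - 1) * n..<q * n} = n"
    using assms by (cases q) auto
  moreover have "(\<Sum>k = 1 + (q - 1) * n..q * n. score u j (Z L \<Delta> k \<omega>)) =
      (\<Sum>i\<in>{(q - 1) * n..<q * n}. score u j (Z L \<Delta> (Suc i) \<omega>))"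
    by (simp only: plus_1_eq_Suc sum.shift_bounds_Suc_ivl flip: atLeastLessThanSuc_atLeastAtMost)
  ultimately show ?thesis
    by (simp add: psi_hat_def sample_score_def score_def)
qed

lemma psi2_hat_full_eq_sample_score: "psi2_hat_full L \<Delta> n \<omega> u = sample_score L \<Delta> {0..<2 * n} u 2 \<omega>"
proof -
  have "(\<Sum>k = 1..2 * n. score u 2 (Z L \<Delta> k \<omega>)) = (\<Sum>i\<in>{0..<2 * n}. score u 2 (Z L \<Delta> (Suc i) \<omega>))"
    by (simp only: One_nat_def sum.shift_bounds_Suc_ivl flip: atLeastLessThanSuc_atLeastAtMost)
  then show ?thesis
    by (simp add: psi2_hat_full_def sample_score_def score_def)
qed

lemma square_sum4_le: "(a + b + c + d)\<^sup>2 \<le> 4 * (a\<^sup>2 + b\<^sup>2 + c\<^sup>2 + d\<^sup>2)" for a b c d :: real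
proof -
  have "4 * (a\<^sup>2 + b\<^sup>2 + c\<^sup>2 + d\<^sup>2) - (a + b + c + d)\<^sup>2 =
     (a - b)\<^sup>2 + (a - c)\<^sup>2 + (a - d)\<^sup>2 + (b - c)\<^sup>2 + (b - d)\<^sup>2 + (c - d)\<^sup>2"
    by (simp add: power2_eq_square algebra_simps)
  moreover have "0 \<le> (a - b)\<^sup>2 + (a - c)\<^sup>2 + (a - d)\<^sup>2 + (b - c)\<^sup>2 + (b - d)\<^sup>2 + (c - d)\<^sup>2"
    by simp
  ultimately show ?thesis by linarith
qed

lemma norm_add_square_le: "(norm (x + y))\<^sup>2 \<le> 2 * (norm x)\<^sup>2 + 2 * (norm y)\<^sup>2" for x y :: complex
proof -
  have "(norm (x + y))\<^sup>2 \<le> (norm x + norm y)\<^sup>2" by (intro power_mono norm_triangle_ineq) simp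
  also have "\<dots> \<le> 2 * (norm x)\<^sup>2 + 2 * (norm y)\<^sup>2"
    using sum_squares_bound[of "norm x" "norm y"] by (simp add: power2_sum)
  finally show ?thesis .
qed

lemma norm_scaled_add_square_le:
  "(norm (of_real r * x + y))\<^sup>2 \<le> 2 * r\<^sup>2 * (norm x)\<^sup>2 + 2 * (norm y)\<^sup>2" for x y :: complex
  using norm_add_square_le[of "of_real r * x" y] by (simp add: norm_mult power_mult_distrib)

text \<open>The difference of products is expanded so that each of the first and the third term contains an error from one
  half of the sample and a factor from the other half, while the remaining terms have deterministic factors. The
  factor \<open>B0\<close>, a mean of characters, is bounded by 1.\<close>
lemma product_difference_bound:
  fixes A1 A2 B1 B0 a1 a2 a0 :: complex
  assumes B0: "norm B0 \<le> 1"
  shows "(norm ((A1 * B1 - A2 * B0) - (a1 * a1 - a2 * a0)))\<^sup>2 \<le>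
    4 * ((norm (A1 - a1))\<^sup>2 * (norm B1)\<^sup>2 + (norm a1)\<^sup>2 * (norm (B1 - a1))\<^sup>2
       + (norm (A2 - a2))\<^sup>2 + (norm a2)\<^sup>2 * (norm (B0 - a0))\<^sup>2)"
proof -
  have "(A1 * B1 - A2 * B0) - (a1 * a1 - a2 * a0) =
     (A1 - a1) * B1 + a1 * (B1 - a1) + - ((A2 - a2) * B0) + - (a2 * (B0 - a0))"
    by (simp add: algebra_simps)
  also have "norm \<dots> \<le> norm ((A1 - a1) * B1) + norm (a1 * (B1 - a1)) + norm (- ((A2 - a2) * B0)) + norm (- (a2 * (B0 - a0)))"
    by (intro order_trans[OF norm_triangle_ineq] add_right_mono order.refl)
  finally have "norm ((A1 * B1 - A2 * B0) - (a1 * a1 - a2 * a0)) \<le>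
      norm (A1 - a1) * norm B1 + norm a1 * norm (B1 - a1) + norm (A2 - a2) * norm B0 + norm a2 * norm (B0 - a0)"
    by (simp add: norm_mult)
  then have "(norm ((A1 * B1 - A2 * B0) - (a1 * a1 - a2 * a0)))\<^sup>2 \<le>
      (norm (A1 - a1) * norm B1 + norm a1 * norm (B1 - a1) + norm (A2 - a2) * norm B0 + norm a2 * norm (B0 - a0))\<^sup>2"
    by (intro power_mono) auto
  also have "\<dots> \<le> 4 * ((norm (A1 - a1) * norm B1)\<^sup>2 + (norm a1 * norm (B1 - a1))\<^sup>2 + (norm (A2 - a2) * norm B0)\<^sup>2 + (norm a2 * norm (B0 - a0))\<^sup>2)"
    by (rule square_sum4_le)
  also have "\<dots> \<le> 4 * ((norm (A1 - a1) * norm B1)\<^sup>2 + (norm a1 * norm (B1 - a1))\<^sup>2 + (norm (A2 - a2))\<^sup>2 + (norm a2 * norm (B0 - a0))\<^sup>2)"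
    using B0 by (intro mult_left_mono add_mono power_mono order.refl mult_left_le) auto
  finally show ?thesis by (simp only: power_mult_distrib)
qed

context pure_jump_levy
begin

context
  fixes \<Delta> :: real
  assumes \<Delta>: "\<Delta> > 0"
begin

lemma Z_measurable: "k \<ge> 1 \<Longrightarrow> Z L \<Delta> k \<in> borel_measurable M"
  unfolding Z_def[abs_def] using \<Delta> by (intro borel_measurable_diff random_variable_L) auto

lemma Z_measurable_Suc[measurable]: "Z L \<Delta> (Suc i) \<in> borel_measurable M"
  by (rule Z_measurable) simp

lemma Z_distribution: "distr M borel (Z L \<Delta> (Suc i)) = distr M borel (L \<Delta>)"
proof -
  have "distr M borel (\<lambda>\<omega>. L (real i * \<Delta> + \<Delta>) \<omega> - L (real i * \<Delta>) \<omega>) = distr M borel (L \<Delta>)"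
    using \<Delta> by (intro stationary_increments) auto
  then show ?thesis by (simp add: Z_def[abs_def] distrib_right add.commute)
qed

lemma Z_independent: "indep_vars (\<lambda>_. borel) (\<lambda>i. Z L \<Delta> (Suc i)) {..<N}"
proof -
  have "indep_vars (\<lambda>_. borel) (\<lambda>i \<omega>. L (real (Suc i) * \<Delta>) \<omega> - L (real i * \<Delta>) \<omega>) {..<N}"
    using \<Delta> by (intro independent_increments[of "\<lambda>i. real i * \<Delta>" N]) (auto intro!: mult_right_mono)
  then show ?thesis by (simp add: Z_def[abs_def])
qed

lemma Z_integrable_iff:
  fixes g :: "real \<Rightarrow> 'b::{banach, second_countable_topology}"
  assumes "g \<in> borel_measurable borel"
  shows "integrable M (\<lambda>\<omega>. g (Z L \<Delta> (Suc i) \<omega>)) \<longleftrightarrow> integrable M (\<lambda>\<omega>. g (L \<Delta> \<omega>))"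
  using integrable_distr_eq[of "Z L \<Delta> (Suc i)" M borel g] integrable_distr_eq[of "L \<Delta>" M borel g] assms \<Delta>
  by (simp add: Z_distribution L_measurable)

lemma Z_expectation:
  fixes g :: "real \<Rightarrow> 'b::{banach, second_countable_topology}"
  assumes "g \<in> borel_measurable borel"
  shows "expectation (\<lambda>\<omega>. g (Z L \<Delta> (Suc i) \<omega>)) = expectation (\<lambda>\<omega>. g (L \<Delta> \<omega>))"
  using integral_distr[of "Z L \<Delta> (Suc i)" M borel g] integral_distr[of "L \<Delta>" M borel g] assms \<Delta>
  by (simp add: Z_distribution L_measurable)

definition moment :: "nat \<Rightarrow> real" where
  "moment j = expectation (\<lambda>\<omega>. L \<Delta> \<omega> ^ (2 * j))"

definition mean_score :: "real \<Rightarrow> nat \<Rightarrow> complex" where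
  "mean_score u j = expectation (\<lambda>\<omega>. score u j (L \<Delta> \<omega>))"

lemma integrable_L_even: "j \<le> 2 \<Longrightarrow> integrable M (\<lambda>\<omega>. L \<Delta> \<omega> ^ (2 * j))"
  using \<Delta> integrable_L_square[of \<Delta>] integrable_L_fourth[of \<Delta>]
  by (auto simp: le_Suc_eq numeral_2_eq_2 numeral_eq_Suc)

lemma score_Z:
  assumes "j \<le> 2"
  shows "integrable M (\<lambda>\<omega>. (norm (score u j (Z L \<Delta> (Suc i) \<omega>)))\<^sup>2)"
    and "expectation (\<lambda>\<omega>. (norm (score u j (Z L \<Delta> (Suc i) \<omega>)))\<^sup>2) = moment j"
    and "expectation (\<lambda>\<omega>. score u j (Z L \<Delta> (Suc i) \<omega>)) = mean_score u j"
  using Z_integrable_iff[of "\<lambda>z. z ^ (2 * j)" i] Z_expectation[of "\<lambda>z. z ^ (2 * j)" i] Z_expectation[of "score u j" i]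
    integrable_L_even[OF assms]
  by (simp_all add: norm_score_square moment_def mean_score_def)

lemma score_Z_independent: "finite A \<Longrightarrow> indep_vars (\<lambda>_. borel) (\<lambda>i \<omega>. score u j (Z L \<Delta> (Suc i) \<omega>)) A"
proof -
  assume "finite A"
  then obtain N where "A \<subseteq> {..<N}" using finite_nat_iff_bounded by blast
  then show ?thesis
    by (intro indep_vars_compose2[OF indep_vars_subset[OF Z_independent]]) auto
qed

lemma sample_score_measurable[measurable]: "sample_score L \<Delta> A u j \<in> borel_measurable M"
  unfolding sample_score_def[abs_def] by measurable

lemma sample_score_error:
  assumes "finite A" "A \<noteq> {}" "j \<le> 2"
  shows "integrable M (\<lambda>\<omega>. (norm (sample_score L \<Delta> A u j \<omega> - mean_score u j))\<^sup>2)"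
    and "expectation (\<lambda>\<omega>. (norm (sample_score L \<Delta> A u j \<omega> - mean_score u j))\<^sup>2) \<le> moment j / real (card A)"
  unfolding sample_score_def
  by (rule mean_square_error_of_sample_mean[where V = "moment j", OF assms(1,2) score_Z_independent[OF assms(1)]];
      simp add: score_Z[OF assms(3)])+

lemma sample_score_square:
  assumes "finite A" "A \<noteq> {}" "j \<le> 2"
  shows "integrable M (\<lambda>\<omega>. (norm (sample_score L \<Delta> A u j \<omega>))\<^sup>2)"
    and "expectation (\<lambda>\<omega>. (norm (sample_score L \<Delta> A u j \<omega>))\<^sup>2) \<le> moment j"
  unfolding sample_score_def
  by (rule mean_square_of_sample_mean[where V = "moment j", OF assms(1,2)]; simp add: score_Z[OF assms(3)])+

lemma norm_mean_score_square_le: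
  assumes "j \<le> 2"
  shows "(norm (mean_score u j))\<^sup>2 \<le> moment j"
proof -
  have [measurable]: "L \<Delta> \<in> borel_measurable M" using \<Delta> by (intro L_measurable) simp
  show ?thesis
    using norm_expectation_square_le[of "\<lambda>\<omega>. score u j (L \<Delta> \<omega>)"] integrable_L_even[OF assms]
    by (simp add: mean_score_def moment_def norm_score_square)
qed

lemma moment_nonneg: "moment j \<ge> 0"
  unfolding moment_def by (intro integral_nonneg_AE) (simp add: power_mult)

lemma moment_0: "moment 0 = 1"
  by (simp add: moment_def prob_space)

lemma moment_1_square_le: "(moment 1)\<^sup>2 \<le> moment 2"
proof -
  have "0 \<le> variance (\<lambda>\<omega>. L \<Delta> \<omega> ^ 2)" by (rule variance_positive)
  also have "\<dots> = expectation (\<lambda>\<omega>. (L \<Delta> \<omega> ^ 2)\<^sup>2) - (expectation (\<lambda>\<omega>. L \<Delta> \<omega> ^ 2))\<^sup>2"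
    using integrable_L_even[of 1] integrable_L_even[of 2] by (intro variance_eq) (simp_all add: power_mult[symmetric])
  finally show ?thesis by (simp add: moment_def power_mult[symmetric])
qed

lemma moment_Z: "expectation (\<lambda>\<omega>. Z L \<Delta> 1 \<omega> ^ 4) = moment 2"
  using Z_expectation[of "\<lambda>z. z ^ 4" 0] by (simp add: moment_def)

lemma mean_score_eq:
  "mean_score u 0 = \<psi> \<Delta> u"
  "mean_score u 1 = of_real \<Delta> * \<phi> u * \<psi> \<Delta> u"
  "mean_score u 2 = (- of_real \<Delta> * fourier h u + (of_real \<Delta> * \<phi> u)\<^sup>2) * \<psi> \<Delta> u"
proof -
  have eq: "mean_score u j = expectation (\<lambda>\<omega>. iexp (u * L \<Delta> \<omega>) * (\<i> * of_real (L \<Delta> \<omega>)) ^ j)" for j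
    by (simp only: mean_score_def score_def mult.commute)
  show "mean_score u 0 = \<psi> \<Delta> u"
    unfolding eq power_0 mult_1_right using \<Delta> by (intro char_L) simp
  show "mean_score u 1 = of_real \<Delta> * \<phi> u * \<psi> \<Delta> u"
    unfolding eq power_one_right using \<Delta> by (intro expectation_first_derivative) simp
  show "mean_score u 2 = (- of_real \<Delta> * fourier h u + (of_real \<Delta> * \<phi> u)\<^sup>2) * \<psi> \<Delta> u"
    unfolding eq using \<Delta> by (intro expectation_second_derivative) simp
qed

lemma norm_sample_score_0: "norm (sample_score L \<Delta> A u 0 \<omega>) \<le> 1"
proof (cases "card A = 0")
  case False
  have "norm (\<Sum>i\<in>A. score u 0 (Z L \<Delta> (Suc i) \<omega>)) \<le> (\<Sum>i\<in>A. 1)"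
    by (intro order_trans[OF norm_sum] sum_mono) (simp add: score_def)
  then have "1 / real (card A) * norm (\<Sum>i\<in>A. score u 0 (Z L \<Delta> (Suc i) \<omega>)) \<le> 1 / real (card A) * real (card A)"
    by (intro mult_left_mono) auto
  then show ?thesis using False by (simp add: sample_score_def norm_mult norm_divide)
qed (simp add: sample_score_def)

text \<open>Only second moments of the scores appear, since the two factors are independent; a Cauchy-Schwarz
  estimate would have needed their fourth moments.\<close>
lemma block_product_error:
  assumes AB: "finite A" "A \<noteq> {}" "finite B" "B \<noteq> {}" "A \<inter> B = {}" and j: "j \<le> 2"
  shows "integrable M (\<lambda>\<omega>. (norm (sample_score L \<Delta> A u j \<omega> - mean_score u j))\<^sup>2 * (norm (sample_score L \<Delta> B u j \<omega>))\<^sup>2)"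
    and "expectation (\<lambda>\<omega>. (norm (sample_score L \<Delta> A u j \<omega> - mean_score u j))\<^sup>2 * (norm (sample_score L \<Delta> B u j \<omega>))\<^sup>2)
      \<le> moment j / real (card A) * moment j"
proof -
  let ?S = "\<lambda>C f. of_real (1 / real (card C)) * (\<Sum>i\<in>C. score u j (f i))"
  let ?F = "\<lambda>f. (norm (?S A f - mean_score u j))\<^sup>2" and ?G = "\<lambda>f. (norm (?S B f))\<^sup>2"
  let ?X = "\<lambda>\<omega> i. Z L \<Delta> (Suc i) \<omega>"
  have S: "?S C (restrict (?X \<omega>) C) = sample_score L \<Delta> C u j \<omega>" for C \<omega>
    unfolding sample_score_def by (intro arg_cong2[where f = "(*)"] sum.cong refl) simp
  have "finite (A \<union> B)" using AB by simp
  then obtain N where N: "A \<union> B \<subseteq> {..<N}" using finite_nat_iff_bounded by blast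
  have sub: "A \<subseteq> {..<N}" "B \<subseteq> {..<N}" using N by auto
  have F: "?F \<in> borel_measurable (PiM A (\<lambda>_. borel))" and G: "?G \<in> borel_measurable (PiM B (\<lambda>_. borel))"
    by measurable
  have iF: "integrable M (\<lambda>\<omega>. ?F (restrict (?X \<omega>) A))"
    unfolding S by (rule sample_score_error(1)[OF AB(1,2) j])
  have iG: "integrable M (\<lambda>\<omega>. ?G (restrict (?X \<omega>) B))"
    unfolding S by (rule sample_score_square(1)[OF AB(3,4) j])
  note prod = expectation_mult_disjoint_blocks[OF Z_independent AB(5) sub F G iF iG, unfolded S]
  show "integrable M (\<lambda>\<omega>. (norm (sample_score L \<Delta> A u j \<omega> - mean_score u j))\<^sup>2 * (norm (sample_score L \<Delta> B u j \<omega>))\<^sup>2)"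
    by (rule prod(1))
  show "expectation (\<lambda>\<omega>. (norm (sample_score L \<Delta> A u j \<omega> - mean_score u j))\<^sup>2 * (norm (sample_score L \<Delta> B u j \<omega>))\<^sup>2)
      \<le> moment j / real (card A) * moment j"
    unfolding prod(2)
    by (intro mult_mono sample_score_error(2)[OF AB(1,2) j] sample_score_square(2)[OF AB(3,4) j])
       (auto intro!: divide_nonneg_nonneg moment_nonneg)
qed

text \<open>Each of the four terms of \<open>product_difference_bound\<close> has expectation at most
  \<open>E Z\<^sup>4 / n\<close>; for the first two this uses \<open>(E Z\<^sup>2)\<^sup>2 \<le> E Z\<^sup>4\<close>.\<close>
lemma split_sample_numerator_error:
  fixes u :: real
  assumes AB: "finite A" "A \<noteq> {}" "finite B" "B \<noteq> {}" "A \<inter> B = {}" and card: "card A = n" "card B = n"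
  defines "D \<equiv> \<lambda>\<omega>. (norm ((sample_score L \<Delta> A u 1 \<omega> * sample_score L \<Delta> B u 1 \<omega> - sample_score L \<Delta> A u 2 \<omega> * sample_score L \<Delta> B u 0 \<omega>)
      - (mean_score u 1 * mean_score u 1 - mean_score u 2 * mean_score u 0)))\<^sup>2"
  shows "integrable M D" and "expectation D \<le> 16 * moment 2 / real n"
proof -
  let ?A = "sample_score L \<Delta> A u" and ?B = "sample_score L \<Delta> B u" and ?a = "mean_score u"
  let ?t = "\<lambda>\<omega>. 4 * ((norm (?A 1 \<omega> - ?a 1))\<^sup>2 * (norm (?B 1 \<omega>))\<^sup>2 + (norm (?a 1))\<^sup>2 * (norm (?B 1 \<omega> - ?a 1))\<^sup>2
       + (norm (?A 2 \<omega> - ?a 2))\<^sup>2 + (norm (?a 2))\<^sup>2 * (norm (?B 0 \<omega> - ?a 0))\<^sup>2)"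
  have D: "D \<omega> \<le> ?t \<omega>" for \<omega>
    unfolding D_def by (rule product_difference_bound[OF norm_sample_score_0])
  note eA = sample_score_error[OF AB(1,2), unfolded card] and eB = sample_score_error[OF AB(3,4), unfolded card]
  note bl = block_product_error[OF AB, of 1, unfolded card]
  have ints: "integrable M (\<lambda>\<omega>. (norm (?A 1 \<omega> - ?a 1))\<^sup>2 * (norm (?B 1 \<omega>))\<^sup>2)" "integrable M (\<lambda>\<omega>. (norm (?B 1 \<omega> - ?a 1))\<^sup>2)"
    "integrable M (\<lambda>\<omega>. (norm (?A 2 \<omega> - ?a 2))\<^sup>2)" "integrable M (\<lambda>\<omega>. (norm (?B 0 \<omega> - ?a 0))\<^sup>2)"
    using bl(1) eA(1)[of 2] eB(1)[of 1] eB(1)[of 0] by simp_all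
  have it: "integrable M ?t"
    using ints by simp
  show iD: "integrable M D"
  proof (rule Bochner_Integration.integrable_bound[OF it])
    show "D \<in> borel_measurable M" unfolding D_def by measurable
    show "AE \<omega> in M. norm (D \<omega>) \<le> norm (?t \<omega>)"
    proof (rule AE_I2)
      fix \<omega>
      have "norm (D \<omega>) = D \<omega>" by (simp add: D_def)
      also note D
      also have "?t \<omega> \<le> norm (?t \<omega>)" unfolding real_norm_def by (rule abs_ge_self)
      finally show "norm (D \<omega>) \<le> norm (?t \<omega>)" .
    qed
  qed
  \<comment> \<open>\<open>moment j\<close> is the moment of order \<open>2 * j\<close>.\<close>
  have m12: "moment 1 / real n * moment 1 \<le> moment 2 / real n"
    using divide_right_mono[OF moment_1_square_le, of "real n"] by (simp add: power2_eq_square)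
  have 1: "expectation (\<lambda>\<omega>. (norm (?A 1 \<omega> - ?a 1))\<^sup>2 * (norm (?B 1 \<omega>))\<^sup>2) \<le> moment 2 / real n"
    using bl(2)[of u] m12 by simp
  have 2: "(norm (?a 1))\<^sup>2 * expectation (\<lambda>\<omega>. (norm (?B 1 \<omega> - ?a 1))\<^sup>2) \<le> moment 2 / real n"
  proof -
    have "(norm (?a 1))\<^sup>2 * expectation (\<lambda>\<omega>. (norm (?B 1 \<omega> - ?a 1))\<^sup>2) \<le> moment 1 * (moment 1 / real n)"
      by (intro mult_mono norm_mean_score_square_le eB(2) moment_nonneg) auto
    with m12 show ?thesis by simp
  qed
  have 3: "expectation (\<lambda>\<omega>. (norm (?A 2 \<omega> - ?a 2))\<^sup>2) \<le> moment 2 / real n"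
    by (rule eA(2)) simp
  have 4: "(norm (?a 2))\<^sup>2 * expectation (\<lambda>\<omega>. (norm (?B 0 \<omega> - ?a 0))\<^sup>2) \<le> moment 2 / real n"
  proof -
    have "(norm (?a 2))\<^sup>2 * expectation (\<lambda>\<omega>. (norm (?B 0 \<omega> - ?a 0))\<^sup>2) \<le> moment 2 * (moment 0 / real n)"
      by (intro mult_mono norm_mean_score_square_le eB(2) moment_nonneg) auto
    then show ?thesis by (simp add: moment_0)
  qed
  have "expectation D \<le> expectation ?t"
    by (rule integral_mono[OF iD it D])
  also have "\<dots> = 4 * (expectation (\<lambda>\<omega>. (norm (?A 1 \<omega> - ?a 1))\<^sup>2 * (norm (?B 1 \<omega>))\<^sup>2)
      + (norm (?a 1))\<^sup>2 * expectation (\<lambda>\<omega>. (norm (?B 1 \<omega> - ?a 1))\<^sup>2)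
      + expectation (\<lambda>\<omega>. (norm (?A 2 \<omega> - ?a 2))\<^sup>2)
      + (norm (?a 2))\<^sup>2 * expectation (\<lambda>\<omega>. (norm (?B 0 \<omega> - ?a 0))\<^sup>2))"
    using ints by simp
  also have "\<dots> \<le> 4 * (moment 2 / real n + moment 2 / real n + moment 2 / real n + moment 2 / real n)"
    by (intro mult_left_mono add_mono 1 2 3 4) simp
  finally show "expectation D \<le> 16 * moment 2 / real n" by simp
qed

end

end

section \<open>Bias and integrated risk\<close>

lemma interval_integral_from_0_derivative:
  fixes f :: "real \<Rightarrow> real"
  assumes f: "\<And>u. isCont f u"
  shows "((\<lambda>u. LBINT v=0..u. f v) has_vector_derivative f u) (at u)"
proof -
  define R where "R = \<bar>u\<bar> + 1"
  have "((\<lambda>u. LBINT v=ereal 0..u. f v) has_vector_derivative f u) (at u within {- R..R})"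
    by (rule interval_integral_FTC2) (auto simp: R_def intro: continuous_at_imp_continuous_on f)
  moreover have "at u within {- R..R} = at u"
    by (rule at_within_interior) (auto simp: R_def abs_if)
  ultimately show ?thesis by (simp add: zero_ereal_def)
qed

context
  fixes h :: "real \<Rightarrow> real" and b :: real
  assumes h: "integrable lborel h"
begin

abbreviation (input) "primitive u \<equiv> LBINT v=0..u. norm (fourier h v)"

lemma primitive_derivative:
  "((\<lambda>u. primitive (ereal u)) has_vector_derivative norm (fourier h u)) (at u)"
  by (rule interval_integral_from_0_derivative) (intro continuous_intros isCont_fourier h)

lemma primitive_mono: "u \<le> v \<Longrightarrow> primitive (ereal u) \<le> primitive (ereal v)"
  by (rule DERIV_nonneg_imp_nondecreasing[where f = "\<lambda>u. primitive (ereal u)"])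
     (auto simp: has_real_derivative_iff_has_vector_derivative
           intro!: exI[of _ "norm (fourier h _)"] primitive_derivative)

lemma isCont_c_fun: "isCont (c_fun b h) u"
  unfolding c_fun_def[abs_def]
  by (intro continuous_intros has_vector_derivative_continuous[OF primitive_derivative])

text \<open>The function \<open>c\<close> increases away from the origin on either side: the primitive of \<open>\<bar>h\<^sup>*\<bar>\<close> is increasing and vanishes
  at \<open>0\<close>.\<close>
lemma c_fun_mono:
  assumes "v \<in> closed_segment 0 u"
  shows "c_fun b h v \<le> c_fun b h u"
proof -
  have zero: "primitive (ereal 0) = 0" by (simp flip: zero_ereal_def)
  show ?thesis
  proof (cases "0 \<le> u")
    case True
    with assms have "0 \<le> v" "v \<le> u" by (auto simp: closed_segment_eq_real_ivl)
    with primitive_mono[of 0 v] primitive_mono[of v u] zero show ?thesis by (simp add: c_fun_def)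
  next
    case False
    with assms have "u \<le> v" "v \<le> 0" by (auto simp: closed_segment_eq_real_ivl)
    with primitive_mono[of u v] primitive_mono[of v 0] zero show ?thesis by (simp add: c_fun_def)
  qed
qed

lemma norm_phi_fun_le_c_fun: "norm (phi_fun b h u) \<le> c_fun b h u"
proof -
  have "interval_lebesgue_integrable lborel (ereal 0) (ereal u) (fourier h)"
    by (rule interval_integrable_isCont) (auto intro: isCont_fourier h)
  then have "norm (LBINT v=0..u. fourier h v) \<le> \<bar>primitive (ereal u)\<bar>"
    using interval_integral_norm2[of 0 "ereal u" "fourier h"] by (simp add: zero_ereal_def)
  then show ?thesis
    unfolding phi_fun_def c_fun_def
    by (intro order_trans[OF norm_triangle_ineq4] add_mono) (simp_all add: norm_mult)
qed

end

context pure_jump_levy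
begin

abbreviation "c \<equiv> c_fun drift h"

lemma norm_\<psi>_le_1:
  assumes "\<Delta> \<ge> 0"
  shows "norm (\<psi> \<Delta> u) \<le> 1"
proof -
  note [measurable] = L_measurable[OF assms]
  interpret D: real_distribution "distr M borel (L \<Delta>)" by (rule real_distribution_distr) simp
  have "\<psi> \<Delta> u = char (distr M borel (L \<Delta>)) u"
    using characteristic_function[OF assms, of u] by (simp add: levy_char_def)
  then show ?thesis using D.cmod_char_le_1[of u] by simp
qed

text \<open>Mean value inequality between \<open>0\<close> and \<open>u\<close> for \<open>\<psi>' = \<Delta> \<phi> \<psi>\<close>, with \<open>\<bar>\<psi>\<bar> \<le> 1\<close> and \<open>\<bar>\<phi>\<bar> \<le> c\<close>.\<close>
lemma norm_\<psi>_minus_1_le: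
  assumes \<Delta>: "\<Delta> \<ge> 0"
  shows "norm (\<psi> \<Delta> u - 1) \<le> \<Delta> * \<bar>u\<bar> * c u"
proof -
  have "norm (\<psi> \<Delta> u - \<psi> \<Delta> 0) \<le> \<Delta> * c u * \<bar>u - 0\<bar>"
  proof (rule norm_diff_le_of_vector_derivative[where S = "closed_segment 0 u"])
    show "(\<psi> \<Delta> has_vector_derivative of_real \<Delta> * \<phi> t * \<psi> \<Delta> t) (at t within closed_segment 0 u)" for t
      by (rule has_vector_derivative_at_within[OF \<psi>_derivative])
    show "norm (of_real \<Delta> * \<phi> t * \<psi> \<Delta> t) \<le> \<Delta> * c u" if "t \<in> closed_segment 0 u" for t
    proof -
      have "norm (\<phi> t) * norm (\<psi> \<Delta> t) \<le> c u * 1"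
        using norm_phi_fun_le_c_fun[OF integrable_h, of drift t] c_fun_mono[OF integrable_h that, of drift] norm_\<psi>_le_1[OF \<Delta>, of t]
        by (intro mult_mono) (auto simp: c_fun_def)
      with \<Delta> show ?thesis by (simp add: norm_mult mult.assoc mult_left_mono)
    qed
  qed auto
  moreover have "\<psi> \<Delta> 0 = 1" by (simp add: levy_char_def levy_exponent_def)
  ultimately show ?thesis by (simp add: mult_ac)
qed

lemma norm_\<psi>_minus_1_square_le:
  assumes \<Delta>: "\<Delta> \<ge> 0"
  shows "(norm (\<psi> \<Delta> u - 1))\<^sup>2 \<le> \<Delta>\<^sup>2 * (u\<^sup>2 * (c u)\<^sup>2)"
proof -
  have "(norm (\<psi> \<Delta> u - 1))\<^sup>2 \<le> (\<Delta> * \<bar>u\<bar> * c u)\<^sup>2"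
    by (intro power_mono norm_\<psi>_minus_1_le \<Delta>) simp
  then show ?thesis by (simp add: power_mult_distrib mult.assoc)
qed

text \<open>Once the orthogonal part \<open>h\<^sub>m - h\<close> is split off for each sample, the expectation can be taken inside the
  integral over the band.\<close>
lemma integrated_risk_le:
  fixes g :: "'a \<Rightarrow> real \<Rightarrow> complex" and G :: "real \<Rightarrow> real"
  assumes meas: "(\<lambda>(\<omega>, u). g \<omega> u) \<in> borel_measurable (M \<Otimes>\<^sub>M lborel)"
    and cont: "\<And>\<omega>. continuous_on (band m) (g \<omega>)"
    and risk: "\<And>u. (\<integral>\<^sup>+ \<omega>. ennreal ((norm (g \<omega> u - fourier h u))\<^sup>2) \<partial>M) \<le> ennreal (G u)"
    and G: "continuous_on (band m) G" "\<And>u. G u \<ge> 0"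
  shows "(\<integral>\<^sup>+ \<omega>. L2_norm_sq (\<lambda>x. spectral_cutoff (g \<omega>) m x - of_real (h x)) \<partial>M)
    \<le> L2_norm_sq (\<lambda>x. h_cutoff h m x - of_real (h x)) + ennreal (1 / (2 * pi) * (LBINT u:band m. G u))"
proof -
  interpret P: pair_sigma_finite M lborel ..
  have [measurable]: "fourier h \<in> borel_measurable borel"
    by (intro borel_measurable_continuous_onI continuous_on_fourier integrable_h)
  note [measurable] = meas
  let ?e = "\<lambda>\<omega> u. ennreal ((norm (g \<omega> u - fourier h u))\<^sup>2)"
  have em[measurable]: "(\<lambda>(\<omega>, u). ?e \<omega> u * indicator (band m) u) \<in> borel_measurable (M \<Otimes>\<^sub>M lborel)"
    by measurable
  have nn: "ennreal (1 / (2 * pi) * (LBINT u:band m. f u)) = ennreal (1 / (2 * pi)) * (\<integral>\<^sup>+ u. ennreal (f u) * indicator (band m) u \<partial>lborel)"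
    if f: "continuous_on (band m) f" "\<And>u. f u \<ge> 0" for f
  proof -
    have int: "integrable lborel (\<lambda>u. indicator (band m) u *\<^sub>R f u)"
      using borel_integrable_atLeastAtMost'[OF f(1)] by (simp add: set_integrable_def)
    have "(\<integral>\<^sup>+ u. ennreal (f u) * indicator (band m) u \<partial>lborel) = (\<integral>\<^sup>+ u. ennreal (indicator (band m) u *\<^sub>R f u) \<partial>lborel)"
      by (intro nn_integral_cong) (simp split: split_indicator)
    also have "\<dots> = ennreal (LBINT u:band m. f u)"
      unfolding set_lebesgue_integral_def using f(2) by (intro nn_integral_eq_integral int) auto
    finally show ?thesis by (simp add: ennreal_mult'[symmetric])
  qed
  have "(\<integral>\<^sup>+ \<omega>. L2_norm_sq (\<lambda>x. spectral_cutoff (g \<omega>) m x - of_real (h x)) \<partial>M) =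
     (\<integral>\<^sup>+ \<omega>. L2_norm_sq (\<lambda>x. h_cutoff h m x - of_real (h x))
       + ennreal (1 / (2 * pi)) * (\<integral>\<^sup>+ u. ?e \<omega> u * indicator (band m) u \<partial>lborel) \<partial>M)"
  proof (intro nn_integral_cong)
    fix \<omega>
    have "continuous_on (band m) (\<lambda>u. (norm (g \<omega> u - fourier h u))\<^sup>2)"
      by (intro continuous_intros cont continuous_on_fourier integrable_h)
    from nn[OF this]
    show "L2_norm_sq (\<lambda>x. spectral_cutoff (g \<omega>) m x - of_real (h x)) = L2_norm_sq (\<lambda>x. h_cutoff h m x - of_real (h x))
       + ennreal (1 / (2 * pi)) * (\<integral>\<^sup>+ u. ?e \<omega> u * indicator (band m) u \<partial>lborel)"
      using L2_norm_sq_cutoff_decomposition[OF cont integrable_h h_square_integrable, of \<omega>] by simp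
  qed
  also have "\<dots> = L2_norm_sq (\<lambda>x. h_cutoff h m x - of_real (h x))
       + ennreal (1 / (2 * pi)) * (\<integral>\<^sup>+ \<omega>. (\<integral>\<^sup>+ u. ?e \<omega> u * indicator (band m) u \<partial>lborel) \<partial>M)"
    by (subst nn_integral_add) (simp_all add: nn_integral_cmult emeasure_space_1)
  also have "(\<integral>\<^sup>+ \<omega>. (\<integral>\<^sup>+ u. ?e \<omega> u * indicator (band m) u \<partial>lborel) \<partial>M) =
      (\<integral>\<^sup>+ u. (\<integral>\<^sup>+ \<omega>. ?e \<omega> u * indicator (band m) u \<partial>M) \<partial>lborel)"
    by (rule P.Fubini'[OF em, symmetric])
  also have "\<dots> = (\<integral>\<^sup>+ u. (\<integral>\<^sup>+ \<omega>. ?e \<omega> u \<partial>M) * indicator (band m) u \<partial>lborel)"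
    by (intro nn_integral_cong) (simp split: split_indicator)
  also have "\<dots> \<le> (\<integral>\<^sup>+ u. ennreal (G u) * indicator (band m) u \<partial>lborel)"
    by (intro nn_integral_mono mult_right_mono risk) simp
  finally show ?thesis
    unfolding nn[OF G] by (simp add: add_left_mono mult_left_mono)
qed

lemma continuous_bias_integrand: "continuous_on S (\<lambda>u. u\<^sup>2 * (c u)\<^sup>2 * (norm (fourier h u))\<^sup>2)"
  by (intro continuous_intros continuous_on_fourier integrable_h continuous_at_imp_continuous_on ballI isCont_c_fun)

lemma continuous_phi_power: "continuous_on S (\<lambda>u. norm (\<phi> u) ^ 4)"
  by (intro continuous_intros continuous_at_imp_continuous_on ballI isCont_\<phi>)

context
  fixes \<Delta> :: real and n :: nat and m :: real
  assumes \<Delta>: "\<Delta> > 0" and n: "n \<ge> 1" and m: "m > 0"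
begin

lemma band_measure: "(LBINT u:band m. K) = 2 * pi * m * K" for K :: real
  using m by (simp add: set_lebesgue_integral_def mult.commute)

text \<open>The bias is \<open>h\<^sup>* (\<psi>\<^sup>2 - 1)\<close>, and \<open>\<bar>\<psi>\<^sup>2 - 1\<bar> \<le> 2 \<bar>\<psi> - 1\<bar>\<close>. The constant 32 is
  \<open>2 * 16\<close>, from the separation of the bias and from \<open>split_sample_numerator_error\<close>.\<close>
lemma h_hat_star_square_error:
  "(\<integral>\<^sup>+ \<omega>. ennreal ((norm (h_hat_star L \<Delta> n \<omega> u - fourier h u))\<^sup>2) \<partial>M)
    \<le> ennreal (32 * moment \<Delta> 2 / (real n * \<Delta>\<^sup>2) + 8 * \<Delta>\<^sup>2 * (u\<^sup>2 * (c u)\<^sup>2 * (norm (fourier h u))\<^sup>2))"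
proof -
  let ?A = "\<lambda>\<omega> j. sample_score L \<Delta> {0..<n} u j \<omega>" and ?B = "\<lambda>\<omega> j. sample_score L \<Delta> {n..<2 * n} u j \<omega>"
  let ?a = "mean_score \<Delta> u"
  let ?d = "\<lambda>\<omega>. (?A \<omega> 1 * ?B \<omega> 1 - ?A \<omega> 2 * ?B \<omega> 0) - (?a 1 * ?a 1 - ?a 2 * ?a 0)"
  let ?K = "2 * (norm (fourier h u * ((\<psi> \<Delta> u)\<^sup>2 - 1)))\<^sup>2"
  have err: "integrable M (\<lambda>\<omega>. (norm (?d \<omega>))\<^sup>2)" "expectation (\<lambda>\<omega>. (norm (?d \<omega>))\<^sup>2) \<le> 16 * moment \<Delta> 2 / real n"
    by (rule split_sample_numerator_error[OF \<Delta>]; use n in simp)+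
  have hat: "h_hat_star L \<Delta> n \<omega> u = of_real (1 / \<Delta>) * (?A \<omega> 1 * ?B \<omega> 1 - ?A \<omega> 2 * ?B \<omega> 0)" for \<omega>
    by (simp add: h_hat_star_def psi_hat_eq_sample_score numeral_2_eq_2)
  have mean: "?a 1 * ?a 1 - ?a 2 * ?a 0 = of_real \<Delta> * fourier h u * (\<psi> \<Delta> u)\<^sup>2"
    unfolding mean_score_eq[OF \<Delta>] by (simp add: power2_eq_square algebra_simps)
  have split: "h_hat_star L \<Delta> n \<omega> u - fourier h u = of_real (1 / \<Delta>) * ?d \<omega> + fourier h u * ((\<psi> \<Delta> u)\<^sup>2 - 1)" for \<omega>
    unfolding hat mean using \<Delta> by (simp add: field_simps)
  have le: "(norm (h_hat_star L \<Delta> n \<omega> u - fourier h u))\<^sup>2 \<le> 2 / \<Delta>\<^sup>2 * (norm (?d \<omega>))\<^sup>2 + ?K" for \<omega>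
    unfolding split
    using norm_scaled_add_square_le[of "1 / \<Delta>" "?d \<omega>" "fourier h u * ((\<psi> \<Delta> u)\<^sup>2 - 1)"]
    by (simp only: power_divide power_one times_divide_eq_right mult_1_right)
  have bias: "(norm (fourier h u * ((\<psi> \<Delta> u)\<^sup>2 - 1)))\<^sup>2 \<le> 4 * \<Delta>\<^sup>2 * (u\<^sup>2 * (c u)\<^sup>2 * (norm (fourier h u))\<^sup>2)"
  proof -
    have "(\<psi> \<Delta> u)\<^sup>2 - 1 = (\<psi> \<Delta> u + 1) * (\<psi> \<Delta> u - 1)"
      by (simp add: power2_eq_square algebra_simps)
    moreover have "norm (\<psi> \<Delta> u + 1) \<le> 2"
      using norm_triangle_ineq[of "\<psi> \<Delta> u" 1] norm_\<psi>_le_1[of \<Delta> u] \<Delta> by simp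
    ultimately have "norm ((\<psi> \<Delta> u)\<^sup>2 - 1) \<le> 2 * norm (\<psi> \<Delta> u - 1)"
      by (simp add: norm_mult mult_right_mono)
    then have "(norm ((\<psi> \<Delta> u)\<^sup>2 - 1))\<^sup>2 \<le> (2 * norm (\<psi> \<Delta> u - 1))\<^sup>2"
      by (intro power_mono) auto
    also have "\<dots> \<le> 4 * (\<Delta>\<^sup>2 * (u\<^sup>2 * (c u)\<^sup>2))"
      using norm_\<psi>_minus_1_square_le[of \<Delta> u] \<Delta> by (simp add: power_mult_distrib)
    finally have "(norm (fourier h u))\<^sup>2 * (norm ((\<psi> \<Delta> u)\<^sup>2 - 1))\<^sup>2 \<le> (norm (fourier h u))\<^sup>2 * (4 * (\<Delta>\<^sup>2 * (u\<^sup>2 * (c u)\<^sup>2)))"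
      by (intro mult_left_mono) auto
    then show ?thesis by (simp add: norm_mult power_mult_distrib mult_ac)
  qed
  have "(\<integral>\<^sup>+ \<omega>. ennreal ((norm (h_hat_star L \<Delta> n \<omega> u - fourier h u))\<^sup>2) \<partial>M) \<le> (\<integral>\<^sup>+ \<omega>. ennreal (2 / \<Delta>\<^sup>2 * (norm (?d \<omega>))\<^sup>2 + ?K) \<partial>M)"
    by (intro nn_integral_mono ennreal_leI le)
  also have "\<dots> = ennreal (expectation (\<lambda>\<omega>. 2 / \<Delta>\<^sup>2 * (norm (?d \<omega>))\<^sup>2 + ?K))"
    using err(1) by (intro nn_integral_eq_integral Bochner_Integration.integrable_add integrable_mult_right) auto
  also have "expectation (\<lambda>\<omega>. 2 / \<Delta>\<^sup>2 * (norm (?d \<omega>))\<^sup>2 + ?K) = 2 / \<Delta>\<^sup>2 * expectation (\<lambda>\<omega>. (norm (?d \<omega>))\<^sup>2) + ?K"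
    using err(1) by (subst Bochner_Integration.integral_add) (auto simp: prob_space)
  also have "ennreal \<dots> \<le> ennreal (2 / \<Delta>\<^sup>2 * (16 * moment \<Delta> 2 / real n) + 2 * (4 * \<Delta>\<^sup>2 * (u\<^sup>2 * (c u)\<^sup>2 * (norm (fourier h u))\<^sup>2)))"
    by (intro ennreal_leI add_mono mult_left_mono err(2) bias) auto
  also have "2 / \<Delta>\<^sup>2 * (16 * moment \<Delta> 2 / real n) + 2 * (4 * \<Delta>\<^sup>2 * (u\<^sup>2 * (c u)\<^sup>2 * (norm (fourier h u))\<^sup>2)) =
      32 * moment \<Delta> 2 / (real n * \<Delta>\<^sup>2) + 8 * \<Delta>\<^sup>2 * (u\<^sup>2 * (c u)\<^sup>2 * (norm (fourier h u))\<^sup>2)"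
    by (simp add: mult_ac)
  finally show ?thesis .
qed

text \<open>The bias is \<open>h\<^sup>* (\<psi> - 1) - \<Delta> \<phi>\<^sup>2 \<psi>\<close>. The factor 2 from its separation is compensated by the sample size
  \<open>2 n\<close> of the mean.\<close>
lemma h_bar_star_square_error:
  "(\<integral>\<^sup>+ \<omega>. ennreal ((norm (h_bar_star L \<Delta> n \<omega> u - fourier h u))\<^sup>2) \<partial>M)
    \<le> ennreal (moment \<Delta> 2 / (real n * \<Delta>\<^sup>2) + 4 * \<Delta>\<^sup>2 * (u\<^sup>2 * (c u)\<^sup>2 * (norm (fourier h u))\<^sup>2) + 4 * \<Delta>\<^sup>2 * norm (\<phi> u) ^ 4)"
proof -
  let ?S = "\<lambda>\<omega>. sample_score L \<Delta> {0..<2 * n} u 2 \<omega>"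
  let ?a = "mean_score \<Delta> u 2"
  let ?b = "fourier h u * (\<psi> \<Delta> u - 1) - of_real \<Delta> * (\<phi> u)\<^sup>2 * \<psi> \<Delta> u"
  have err: "integrable M (\<lambda>\<omega>. (norm (?S \<omega> - ?a))\<^sup>2)" "expectation (\<lambda>\<omega>. (norm (?S \<omega> - ?a))\<^sup>2) \<le> moment \<Delta> 2 / (2 * real n)"
    using sample_score_error[OF \<Delta>, of "{0..<2 * n}" 2 u] n by simp_all
  have split: "h_bar_star L \<Delta> n \<omega> u - fourier h u = of_real (- 1 / \<Delta>) * (?S \<omega> - ?a) + ?b" for \<omega>
    unfolding mean_score_eq[OF \<Delta>] h_bar_star_def psi2_hat_full_eq_sample_score
    using \<Delta> by (simp add: field_simps power2_eq_square)
  have le: "(norm (h_bar_star L \<Delta> n \<omega> u - fourier h u))\<^sup>2 \<le> 2 / \<Delta>\<^sup>2 * (norm (?S \<omega> - ?a))\<^sup>2 + 2 * (norm ?b)\<^sup>2" for \<omega>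
    unfolding split
    using norm_scaled_add_square_le[of "- 1 / \<Delta>" "?S \<omega> - ?a" ?b]
    by (simp only: power_divide power2_minus power_one times_divide_eq_right mult_1_right)
  have bias: "(norm ?b)\<^sup>2 \<le> 2 * (\<Delta>\<^sup>2 * (u\<^sup>2 * (c u)\<^sup>2 * (norm (fourier h u))\<^sup>2)) + 2 * (\<Delta>\<^sup>2 * norm (\<phi> u) ^ 4)"
  proof -
    have 1: "(norm (fourier h u * (\<psi> \<Delta> u - 1)))\<^sup>2 \<le> \<Delta>\<^sup>2 * (u\<^sup>2 * (c u)\<^sup>2 * (norm (fourier h u))\<^sup>2)"
      using mult_left_mono[OF norm_\<psi>_minus_1_square_le[of \<Delta> u], of "(norm (fourier h u))\<^sup>2"] \<Delta>
      by (simp add: norm_mult power_mult_distrib mult_ac)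
    have "(norm (of_real \<Delta> * (\<phi> u)\<^sup>2 * \<psi> \<Delta> u))\<^sup>2 = \<Delta>\<^sup>2 * norm (\<phi> u) ^ 4 * (norm (\<psi> \<Delta> u))\<^sup>2"
      by (simp add: norm_mult norm_power power_mult_distrib power_mult[symmetric])
    also have "\<dots> \<le> \<Delta>\<^sup>2 * norm (\<phi> u) ^ 4"
      using norm_\<psi>_le_1[of \<Delta> u] \<Delta> by (intro mult_left_le) (auto intro: power_le_one)
    finally have 2: "(norm (of_real \<Delta> * (\<phi> u)\<^sup>2 * \<psi> \<Delta> u))\<^sup>2 \<le> \<Delta>\<^sup>2 * norm (\<phi> u) ^ 4" .
    have "(norm ?b)\<^sup>2 \<le> 2 * (norm (fourier h u * (\<psi> \<Delta> u - 1)))\<^sup>2 + 2 * (norm (of_real \<Delta> * (\<phi> u)\<^sup>2 * \<psi> \<Delta> u))\<^sup>2"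
      using norm_add_square_le[of "fourier h u * (\<psi> \<Delta> u - 1)" "- (of_real \<Delta> * (\<phi> u)\<^sup>2 * \<psi> \<Delta> u)"]
      by (simp only: norm_minus_cancel add_uminus_conv_diff)
    with 1 2 show ?thesis by linarith
  qed
  have "(\<integral>\<^sup>+ \<omega>. ennreal ((norm (h_bar_star L \<Delta> n \<omega> u - fourier h u))\<^sup>2) \<partial>M) \<le> (\<integral>\<^sup>+ \<omega>. ennreal (2 / \<Delta>\<^sup>2 * (norm (?S \<omega> - ?a))\<^sup>2 + 2 * (norm ?b)\<^sup>2) \<partial>M)"
    by (intro nn_integral_mono ennreal_leI le)
  also have "\<dots> = ennreal (expectation (\<lambda>\<omega>. 2 / \<Delta>\<^sup>2 * (norm (?S \<omega> - ?a))\<^sup>2 + 2 * (norm ?b)\<^sup>2))"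
    using err(1) by (intro nn_integral_eq_integral Bochner_Integration.integrable_add integrable_mult_right) auto
  also have "expectation (\<lambda>\<omega>. 2 / \<Delta>\<^sup>2 * (norm (?S \<omega> - ?a))\<^sup>2 + 2 * (norm ?b)\<^sup>2) = 2 / \<Delta>\<^sup>2 * expectation (\<lambda>\<omega>. (norm (?S \<omega> - ?a))\<^sup>2) + 2 * (norm ?b)\<^sup>2"
    using err(1) by (subst Bochner_Integration.integral_add) (auto simp: prob_space)
  also have "ennreal \<dots> \<le> ennreal (2 / \<Delta>\<^sup>2 * (moment \<Delta> 2 / (2 * real n)) + 2 * (2 * (\<Delta>\<^sup>2 * (u\<^sup>2 * (c u)\<^sup>2 * (norm (fourier h u))\<^sup>2)) + 2 * (\<Delta>\<^sup>2 * norm (\<phi> u) ^ 4)))"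
    by (intro ennreal_leI add_mono[OF mult_left_mono[OF err(2)] mult_left_mono[OF bias]]) auto
  also have "2 / \<Delta>\<^sup>2 * (moment \<Delta> 2 / (2 * real n)) + 2 * (2 * (\<Delta>\<^sup>2 * (u\<^sup>2 * (c u)\<^sup>2 * (norm (fourier h u))\<^sup>2)) + 2 * (\<Delta>\<^sup>2 * norm (\<phi> u) ^ 4)) =
      moment \<Delta> 2 / (real n * \<Delta>\<^sup>2) + 4 * \<Delta>\<^sup>2 * (u\<^sup>2 * (c u)\<^sup>2 * (norm (fourier h u))\<^sup>2) + 4 * \<Delta>\<^sup>2 * norm (\<phi> u) ^ 4"
    by (simp add: mult_ac distrib_left)
  finally show ?thesis .
qed

lemma sample_score_jointly_measurable:
  "(\<lambda>(\<omega>, u). sample_score L \<Delta> A u j \<omega>) \<in> borel_measurable (M \<Otimes>\<^sub>M lborel)"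
proof -
  note [measurable] = Z_measurable_Suc[OF \<Delta>]
  show ?thesis unfolding sample_score_def score_def by measurable
qed

lemma continuous_sample_score: "continuous_on S (\<lambda>u. sample_score L \<Delta> A u j \<omega>)"
  unfolding sample_score_def score_def by (intro continuous_intros)

lemma h_hat_risk:
  "(\<integral>\<^sup>+ \<omega>. L2_norm_sq (\<lambda>x. h_hat L \<Delta> n m \<omega> x - of_real (h x)) \<partial>M)
     \<le> L2_norm_sq (\<lambda>x. h_cutoff h m x - of_real (h x))
       + ennreal (72 * (LINT \<omega>|M. (Z L \<Delta> 1 \<omega>) ^ 4 / \<Delta>) * (m / (real n * \<Delta>)) + 4 * \<Delta>\<^sup>2 / pi * bias_integral drift h m)"
proof -
  let ?G = "\<lambda>u. 32 * moment \<Delta> 2 / (real n * \<Delta>\<^sup>2) + 8 * \<Delta>\<^sup>2 * (u\<^sup>2 * (c u)\<^sup>2 * (norm (fourier h u))\<^sup>2)"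
  note [measurable] = sample_score_jointly_measurable
  have star: "h_hat_star L \<Delta> n \<omega> u = of_real (1 / \<Delta>) *
     (sample_score L \<Delta> {0..<n} u 1 \<omega> * sample_score L \<Delta> {n..<2 * n} u 1 \<omega> - sample_score L \<Delta> {0..<n} u 2 \<omega> * sample_score L \<Delta> {n..<2 * n} u 0 \<omega>)" for \<omega> u
    by (simp add: h_hat_star_def psi_hat_eq_sample_score numeral_2_eq_2)
  have "(\<integral>\<^sup>+ \<omega>. L2_norm_sq (\<lambda>x. h_hat L \<Delta> n m \<omega> x - of_real (h x)) \<partial>M)
     \<le> L2_norm_sq (\<lambda>x. h_cutoff h m x - of_real (h x)) + ennreal (1 / (2 * pi) * (LBINT u:band m. ?G u))"
    unfolding h_hat_def
  proof (rule integrated_risk_le)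
    show "(\<lambda>(\<omega>, u). h_hat_star L \<Delta> n \<omega> u) \<in> borel_measurable (M \<Otimes>\<^sub>M lborel)"
      unfolding star by measurable
    show "continuous_on (band m) (h_hat_star L \<Delta> n \<omega>)" for \<omega>
      unfolding star[abs_def] by (intro continuous_intros continuous_sample_score)
    show "continuous_on (band m) ?G"
      by (intro continuous_on_add continuous_on_mult continuous_on_const continuous_bias_integrand[unfolded mult.assoc] continuous_bias_integrand)
    show "?G u \<ge> 0" for u
      using moment_nonneg[OF \<Delta>, of 2] by simp
  qed (rule h_hat_star_square_error)
  also have "(LBINT u:band m. ?G u) = 2 * pi * m * (32 * moment \<Delta> 2 / (real n * \<Delta>\<^sup>2)) + 8 * \<Delta>\<^sup>2 * bias_integral drift h m"
  proof -
    have i: "set_integrable lborel (band m) (\<lambda>u. u\<^sup>2 * (c u)\<^sup>2 * (norm (fourier h u))\<^sup>2)"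
      by (rule borel_integrable_atLeastAtMost'[OF continuous_bias_integrand])
    have k: "set_integrable lborel (band m) (\<lambda>u. 32 * moment \<Delta> 2 / (real n * \<Delta>\<^sup>2))"
      by (rule borel_integrable_atLeastAtMost') simp
    show ?thesis
      unfolding set_integral_add(2)[OF k set_integrable_mult_right[OF i]] band_measure bias_integral_def set_integral_mult_right ..
  qed
  also have "1 / (2 * pi) * (2 * pi * m * (32 * moment \<Delta> 2 / (real n * \<Delta>\<^sup>2)) + 8 * \<Delta>\<^sup>2 * bias_integral drift h m) =
     32 * (moment \<Delta> 2 / \<Delta>) * (m / (real n * \<Delta>)) + 4 * \<Delta>\<^sup>2 / pi * bias_integral drift h m"
    by (simp add: field_simps power2_eq_square)
  also have "ennreal \<dots> \<le> ennreal (72 * (moment \<Delta> 2 / \<Delta>) * (m / (real n * \<Delta>)) + 4 * \<Delta>\<^sup>2 / pi * bias_integral drift h m)"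
    using moment_nonneg[OF \<Delta>, of 2] m \<Delta> by (intro ennreal_leI add_right_mono mult_right_mono) auto
  also have "moment \<Delta> 2 / \<Delta> = (LINT \<omega>|M. (Z L \<Delta> 1 \<omega>) ^ 4 / \<Delta>)"
    using moment_Z[OF \<Delta>] by simp
  finally show ?thesis by (simp add: add_left_mono)
qed

lemma h_bar_risk:
  "(\<integral>\<^sup>+ \<omega>. L2_norm_sq (\<lambda>x. h_bar L \<Delta> n m \<omega> x - of_real (h x)) \<partial>M)
     \<le> L2_norm_sq (\<lambda>x. h_cutoff h m x - of_real (h x))
       + ennreal ((LINT \<omega>|M. (Z L \<Delta> 1 \<omega>) ^ 4 / \<Delta>) * (m / (real n * \<Delta>)) + 2 * \<Delta>\<^sup>2 / pi * bias_integral drift h m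
           + \<Delta>\<^sup>2 * B_fun drift h m)"
proof -
  let ?G = "\<lambda>u. moment \<Delta> 2 / (real n * \<Delta>\<^sup>2) + 4 * \<Delta>\<^sup>2 * (u\<^sup>2 * (c u)\<^sup>2 * (norm (fourier h u))\<^sup>2) + 4 * \<Delta>\<^sup>2 * norm (\<phi> u) ^ 4"
  note [measurable] = sample_score_jointly_measurable
  have star: "h_bar_star L \<Delta> n \<omega> u = - of_real (1 / \<Delta>) * sample_score L \<Delta> {0..<2 * n} u 2 \<omega>" for \<omega> u
    by (simp add: h_bar_star_def psi2_hat_full_eq_sample_score)
  have "(\<integral>\<^sup>+ \<omega>. L2_norm_sq (\<lambda>x. h_bar L \<Delta> n m \<omega> x - of_real (h x)) \<partial>M)
     \<le> L2_norm_sq (\<lambda>x. h_cutoff h m x - of_real (h x)) + ennreal (1 / (2 * pi) * (LBINT u:band m. ?G u))"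
    unfolding h_bar_def
  proof (rule integrated_risk_le)
    show "(\<lambda>(\<omega>, u). h_bar_star L \<Delta> n \<omega> u) \<in> borel_measurable (M \<Otimes>\<^sub>M lborel)"
      unfolding star by measurable
    show "continuous_on (band m) (h_bar_star L \<Delta> n \<omega>)" for \<omega>
      unfolding star[abs_def] by (intro continuous_intros continuous_sample_score)
    show "continuous_on (band m) ?G"
      by (intro continuous_on_add continuous_on_mult[OF continuous_on_const] continuous_on_const continuous_bias_integrand continuous_phi_power)
    show "?G u \<ge> 0" for u
      using moment_nonneg[OF \<Delta>, of 2] by simp
  qed (rule h_bar_star_square_error)
  also have "(LBINT u:band m. ?G u) = 2 * pi * m * (moment \<Delta> 2 / (real n * \<Delta>\<^sup>2)) + 4 * \<Delta>\<^sup>2 * bias_integral drift h m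
      + 4 * \<Delta>\<^sup>2 * (LBINT u:band m. norm (\<phi> u) ^ 4)"
  proof -
    have i: "set_integrable lborel (band m) (\<lambda>u. u\<^sup>2 * (c u)\<^sup>2 * (norm (fourier h u))\<^sup>2)"
      by (rule borel_integrable_atLeastAtMost'[OF continuous_bias_integrand])
    have i4: "set_integrable lborel (band m) (\<lambda>u. norm (\<phi> u) ^ 4)"
      by (rule borel_integrable_atLeastAtMost'[OF continuous_phi_power])
    have k: "set_integrable lborel (band m) (\<lambda>u. moment \<Delta> 2 / (real n * \<Delta>\<^sup>2))"
      by (rule borel_integrable_atLeastAtMost') simp
    show ?thesis
      unfolding set_integral_add(2)[OF set_integral_add(1)[OF k set_integrable_mult_right[OF i]] set_integrable_mult_right[OF i4]]
        set_integral_add(2)[OF k set_integrable_mult_right[OF i]] band_measure bias_integral_def set_integral_mult_right ..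
  qed
  also have "1 / (2 * pi) * (2 * pi * m * (moment \<Delta> 2 / (real n * \<Delta>\<^sup>2)) + 4 * \<Delta>\<^sup>2 * bias_integral drift h m
      + 4 * \<Delta>\<^sup>2 * (LBINT u:band m. norm (\<phi> u) ^ 4)) =
     (moment \<Delta> 2 / \<Delta>) * (m / (real n * \<Delta>)) + 2 * \<Delta>\<^sup>2 / pi * bias_integral drift h m + \<Delta>\<^sup>2 * B_fun drift h m"
    unfolding B_fun_def by (simp add: field_simps power2_eq_square)
  also have "moment \<Delta> 2 / \<Delta> = (LINT \<omega>|M. (Z L \<Delta> 1 \<omega>) ^ 4 / \<Delta>)"
    using moment_Z[OF \<Delta>] by simp
  finally show ?thesis .
qed

end

end

section \<open>Growth of the integral of \<open>\<bar>\<phi>\<bar>\<^sup>4\<close>\<close>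

context pure_jump_levy
begin

lemma B_fun_le:
  assumes m: "m \<ge> 0" and K: "\<And>u. \<bar>u\<bar> \<le> pi * m \<Longrightarrow> norm (\<phi> u) \<le> K"
  shows "norm (B_fun drift h m) \<le> 4 * K ^ 4 * m"
proof -
  have i4: "set_integrable lborel (band m) (\<lambda>u. norm (\<phi> u) ^ 4)"
    by (rule borel_integrable_atLeastAtMost'[OF continuous_phi_power])
  have k: "set_integrable lborel (band m) (\<lambda>u. K ^ 4)"
    by (rule borel_integrable_atLeastAtMost') simp
  have "(LBINT u:band m. norm (\<phi> u) ^ 4) \<le> (LBINT u:band m. K ^ 4)"
    by (rule set_integral_mono[OF i4 k]) (auto intro!: power_mono K)
  also have "\<dots> = 2 * pi * m * K ^ 4"
    using m by (simp add: set_lebesgue_integral_def mult.commute)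
  finally have "2 / pi * (LBINT u:band m. norm (\<phi> u) ^ 4) \<le> 2 / pi * (2 * pi * m * K ^ 4)"
    by (intro mult_left_mono) auto
  then have "B_fun drift h m \<le> 4 * K ^ 4 * m" by (simp add: B_fun_def mult_ac)
  moreover have "B_fun drift h m \<ge> 0"
    unfolding B_fun_def set_lebesgue_integral_def by (intro mult_nonneg_nonneg integral_nonneg_AE) auto
  ultimately show ?thesis by simp
qed

text \<open>The derivative \<open>- h\<^sup>*\<close> of \<open>\<phi>\<close> is bounded by the integral of \<open>\<bar>h\<bar>\<close>.\<close>
lemma norm_\<phi>_le_linear: "norm (\<phi> u) \<le> \<bar>drift\<bar> + (LINT x|lborel. norm (h x)) * \<bar>u\<bar>"
proof -
  have b: "norm (fourier h v) \<le> (LINT x|lborel. norm (h x))" for v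
    unfolding fourier_def by (rule order_trans[OF integral_norm_bound]) (simp add: norm_mult)
  have "norm (\<phi> u - \<phi> 0) \<le> (LINT x|lborel. norm (h x)) * \<bar>u - 0\<bar>"
    by (rule norm_diff_le_of_vector_derivative[where S = UNIV and f' = "\<lambda>u. - fourier h u"])
       (use b \<phi>_derivative in auto)
  moreover have "norm (\<phi> 0) = \<bar>drift\<bar>" by (simp add: phi_fun_def norm_mult flip: zero_ereal_def)
  ultimately show ?thesis using norm_triangle_ineq[of "\<phi> 0" "\<phi> u - \<phi> 0"] by simp
qed

lemma norm_\<phi>_le_const:
  assumes int: "integrable lborel (fourier h)"
  shows "norm (\<phi> u) \<le> \<bar>drift\<bar> + (LINT v|lborel. norm (fourier h v))"
proof -
  have "\<bar>LBINT v=0..u. norm (fourier h v)\<bar> \<le> (LINT v|lborel. norm (fourier h v))"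
  proof -
    have set: "\<bar>LBINT v:S. norm (fourier h v)\<bar> \<le> (LINT v|lborel. norm (fourier h v))" if [measurable]: "S \<in> sets lborel" for S
    proof -
      have "(LBINT v:S. norm (fourier h v)) \<le> (LINT v|lborel. norm (fourier h v))"
        unfolding set_lebesgue_integral_def
        using int that by (intro integral_mono integrable_mult_indicator) (auto split: split_indicator)
      moreover have "(LBINT v:S. norm (fourier h v)) \<ge> 0"
        unfolding set_lebesgue_integral_def by (intro integral_nonneg_AE) auto
      ultimately show ?thesis by simp
    qed
    show ?thesis
      using set[of "einterval 0 u"] set[of "einterval u 0"]
      by (simp add: interval_lebesgue_integral_def)
  qed
  then show ?thesis
    using norm_phi_fun_le_c_fun[OF integrable_h, of drift u] by (simp add: c_fun_def)
qed

lemma B_fun_linear: "integrable lborel (fourier h) \<Longrightarrow> (\<lambda>m. B_fun drift h m) \<in> O[at_top](\<lambda>m. m)"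
  by (rule bigoI[where c = "4 * (\<bar>drift\<bar> + (LINT v|lborel. norm (fourier h v))) ^ 4"])
     (use eventually_ge_at_top[of 0] in \<open>eventually_elim, use B_fun_le norm_\<phi>_le_const in auto\<close>)

lemma B_fun_quintic: "(\<lambda>m. B_fun drift h m) \<in> O[at_top](\<lambda>m. m ^ 5)"
proof (rule bigoI)
  let ?I = "LINT x|lborel. norm (h x)"
  show "\<forall>\<^sub>F m in at_top. norm (B_fun drift h m) \<le> 4 * (\<bar>drift\<bar> + ?I * pi) ^ 4 * norm (m ^ 5)"
    using eventually_ge_at_top[of 1]
  proof eventually_elim
    case (elim m)
    have "norm (\<phi> u) \<le> (\<bar>drift\<bar> + ?I * pi) * m" if "\<bar>u\<bar> \<le> pi * m" for u
    proof -
      have "norm (\<phi> u) \<le> \<bar>drift\<bar> * 1 + ?I * \<bar>u\<bar>" using norm_\<phi>_le_linear[of u] by simp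
      also have "\<dots> \<le> \<bar>drift\<bar> * m + ?I * (pi * m)"
        using elim that by (intro add_mono mult_left_mono) auto
      finally show ?thesis by (simp add: algebra_simps)
    qed
    then have "norm (B_fun drift h m) \<le> 4 * ((\<bar>drift\<bar> + ?I * pi) * m) ^ 4 * m"
      using elim by (intro B_fun_le) auto
    also have "\<dots> = 4 * (\<bar>drift\<bar> + ?I * pi) ^ 4 * norm (m ^ 5)"
      using elim by (simp add: power_mult_distrib numeral_eq_Suc)
    finally show ?case .
  qed
qed

end

theorem proposition3p1:
  "\<exists>C::real. C > 0 \<and>
     (\<forall>(M :: 'a measure) (L :: real \<Rightarrow> 'a \<Rightarrow> real) (\<nu> :: real \<Rightarrow> real) (h :: real \<Rightarrow> real) (b :: real).
        pure_jump_levy M L \<nu> \<and> h = levy_h \<nu> \<and> b = levy_mean M L \<longrightarrow>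
        (\<forall>(\<Delta> :: real) (n :: nat) (m :: real). \<Delta> > 0 \<and> n \<ge> 1 \<and> m > 0 \<longrightarrow>
           (\<integral>\<^sup>+ \<omega>. L2_norm_sq (\<lambda>x. h_hat L \<Delta> n m \<omega> x - of_real (h x)) \<partial>M)
             \<le> L2_norm_sq (\<lambda>x. h_cutoff h m x - of_real (h x))
               + ennreal (72 * (LINT \<omega>|M. (Z L \<Delta> 1 \<omega>) ^ 4 / \<Delta>) * (m / (real n * \<Delta>))
                          + 4 * \<Delta>\<^sup>2 / pi * bias_integral b h m)
           \<and>
           (\<integral>\<^sup>+ \<omega>. L2_norm_sq (\<lambda>x. h_bar L \<Delta> n m \<omega> x - of_real (h x)) \<partial>M)
             \<le> L2_norm_sq (\<lambda>x. h_cutoff h m x - of_real (h x))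
               + ennreal ((LINT \<omega>|M. (Z L \<Delta> 1 \<omega>) ^ 4 / \<Delta>) * (m / (real n * \<Delta>))
                          + 2 * \<Delta>\<^sup>2 / pi * bias_integral b h m
                          + C * \<Delta>\<^sup>2 * B_fun b h m))
        \<and> (integrable lborel (fourier h) \<longrightarrow> (\<lambda>m. B_fun b h m) \<in> O[at_top](\<lambda>m. m))
        \<and> (\<not> integrable lborel (fourier h) \<longrightarrow> (\<lambda>m. B_fun b h m) \<in> O[at_top](\<lambda>m. m ^ 5)))"
proof (intro exI[of _ 1] conjI allI impI; (elim conjE)?)
  fix M :: "'a measure" and L :: "real \<Rightarrow> 'a \<Rightarrow> real" and \<nu> h :: "real \<Rightarrow> real" and b \<Delta> m :: real and n :: nat
  assume levy: "pure_jump_levy M L \<nu>" and hb: "h = levy_h \<nu>" "b = levy_mean M L"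
  note risks = pure_jump_levy.h_hat_risk[OF levy] pure_jump_levy.h_bar_risk[OF levy]
  note growth = pure_jump_levy.B_fun_linear[OF levy] pure_jump_levy.B_fun_quintic[OF levy]
  show "(\<lambda>m. B_fun b h m) \<in> O[at_top](\<lambda>m. m)" if "integrable lborel (fourier h)"
    using growth(1) that hb by simp
  show "(\<lambda>m. B_fun b h m) \<in> O[at_top](\<lambda>m. m ^ 5)"
    using growth(2) hb by simp
  assume pos: "\<Delta> > 0" "n \<ge> 1" "m > 0"
  show "(\<integral>\<^sup>+ \<omega>. L2_norm_sq (\<lambda>x. h_hat L \<Delta> n m \<omega> x - of_real (h x)) \<partial>M)
             \<le> L2_norm_sq (\<lambda>x. h_cutoff h m x - of_real (h x))
               + ennreal (72 * (LINT \<omega>|M. (Z L \<Delta> 1 \<omega>) ^ 4 / \<Delta>) * (m / (real n * \<Delta>))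
                          + 4 * \<Delta>\<^sup>2 / pi * bias_integral b h m)"
    unfolding hb by (rule risks(1)[OF pos])
  show "(\<integral>\<^sup>+ \<omega>. L2_norm_sq (\<lambda>x. h_bar L \<Delta> n m \<omega> x - of_real (h x)) \<partial>M)
             \<le> L2_norm_sq (\<lambda>x. h_cutoff h m x - of_real (h x))
               + ennreal ((LINT \<omega>|M. (Z L \<Delta> 1 \<omega>) ^ 4 / \<Delta>) * (m / (real n * \<Delta>))
                          + 2 * \<Delta>\<^sup>2 / pi * bias_integral b h m
                          + 1 * \<Delta>\<^sup>2 * B_fun b h m)"
    unfolding hb mult_1_left by (rule risks(2)[OF pos])
qed simp

end
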